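(* Let $A$ and $B$ be two (not necessarily unital) strongly Morita equivalent C*-algebras and let $X$ be a $B$-$A$ imprimitivity bimodule with $A$-valued inner product $\langle\cdot,\cdot\rangle_A$ and $B$-valued inner product $\langle\cdot,\cdot\rangle_B$. Then the set of all bijective bounded $A$-linear operators $T: X\to X$ which preserve both inner products, i.e. $\langle T(x),T(y)\rangle_A = \langle x,y\rangle_A$ and $\langle T(x),T(y)\rangle_B = \langle x,y\rangle_B$ for all $x,y\in X$, coincides with the set $$\{ u\cdot \mathrm{id}_X : u \in Z(M(A)) = Z(M(B)) \text{ unitary}\}.$$ Likewise, the set of all bijective bounded $B$-linear operators $T: X \to X$ which preserve both inner products coincides with this same set.
   Context: Here $M(\cdot)$ denotes the multiplier algebra and $Z(\cdot)$ the center. A $B$-$A$ imprimitivity bimodule $X$ is a full left Hilbert $A$-module (with $\langle\cdot,\cdot\rangle_A$ being $A$-linear in the first variable) which is at the same time a full right Hilbert $B$-module (with $\langle\cdot,\cdot\rangle_B$ being $B$-linear in the second variable) such that $\langle x,y\rangle_A z = x\langle y,z\rangle_B$ for all $x,y,z\in X$; the right action of $B$ then identifies $B$ with the C*-algebra $\mathrm{K}_A(X)$ of "compact" $A$-linear operators on $X$. Full means that the closed linear hull of the inner product values is the whole C*-algebra. $A$ and $B$ are strongly Morita equivalent if a $B$-$A$ imprimitivity bimodule exists. The actions of $A$ and $B$ on $X$ extend canonically to $M(A)$ and $M(B)$; the identification $Z(M(A)) = Z(M(B))$ is the canonical $*$-isomorphism under which corresponding elements act as the same operator on $X$, and $u\cdot\mathrm{id}_X$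 denotes the operator $x\mapsto ux$. *)

theory Defs
  imports "HOL-Analysis.Analysis"
begin

section \<open>Complex normed spaces\<close>

class scaleC =
  fixes scaleC :: "complex \<Rightarrow> 'a \<Rightarrow> 'a"  (infixr "*\<^sub>C" 75)

class complex_vector = scaleC + real_vector +
  assumes scaleC_add_right: "c *\<^sub>C (x + y) = c *\<^sub>C x + c *\<^sub>C y"
    and scaleC_add_left: "(c + d) *\<^sub>C x = c *\<^sub>C x + d *\<^sub>C x"
    and scaleC_scaleC: "c *\<^sub>C d *\<^sub>C x = (c * d) *\<^sub>C x"
    and scaleC_of_real: "complex_of_real r *\<^sub>C x = r *\<^sub>R x"

class complex_normed_vector = complex_vector + real_normed_vector +
  assumes norm_scaleC: "norm (c *\<^sub>C x) = cmod c * norm x"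

interpretation complex_vector: vector_space "scaleC :: complex \<Rightarrow> 'a \<Rightarrow> 'a::complex_vector"
proof
  show "1 *\<^sub>C x = x" for x :: 'a
    using scaleC_of_real[of 1 x] by simp
qed (simp_all add: scaleC_add_right scaleC_add_left scaleC_scaleC)

definition bounded_clinear ::
    "('a::complex_normed_vector \<Rightarrow> 'b::complex_normed_vector) \<Rightarrow> bool"
  where "bounded_clinear f \<longleftrightarrow> bounded_linear f \<and> (\<forall>c x. f (c *\<^sub>C x) = c *\<^sub>C f x)"


section \<open>C*-algebras, not necessarily unital\<close>

class star =
  fixes star :: "'a \<Rightarrow> 'a"

class star_algebra = complex_vector + ring + star +
  assumes mult_scaleC_left: "(c *\<^sub>C x) * y = c *\<^sub>C (x * y)"
    and mult_scaleC_right: "x * (c *\<^sub>C y) = c *\<^sub>C (x * y)"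
    and star_add: "star (x + y) = star x + star y"
    and star_scaleC: "star (c *\<^sub>C x) = cnj c *\<^sub>C star x"
    and star_mult: "star (x * y) = star y * star x"
    and star_star: "star (star x) = x"

class cstar_algebra = star_algebra + complex_normed_vector + real_normed_algebra + banach +
  assumes cstar_identity: "norm (star x * x) = (norm x)\<^sup>2"

definition cstar_positive :: "'a::cstar_algebra \<Rightarrow> bool"
  where "cstar_positive a \<longleftrightarrow> (\<exists>c. a = star c * c)"

definition center :: "'a::star_algebra set"
  where "center = {z. \<forall>a. z * a = a * z}"

definition unitary :: "'a::{star_algebra, monoid_mult} \<Rightarrow> bool"
  where "unitary u \<longleftrightarrow> star u * u = 1 \<and> u * star u = 1"

definition star_isomorphism_on ::
    "'a::star_algebra set \<Rightarrow> 'b::star_algebra set \<Rightarrow> ('a \<Rightarrow> 'b) \<Rightarrow> bool"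
  where "star_isomorphism_on S S' \<Phi> \<longleftrightarrow>
    bij_betw \<Phi> S S' \<and>
    (\<forall>x\<in>S. \<forall>y\<in>S. \<Phi> (x + y) = \<Phi> x + \<Phi> y \<and> \<Phi> (x * y) = \<Phi> x * \<Phi> y) \<and>
    (\<forall>c. \<forall>x\<in>S. \<Phi> (c *\<^sub>C x) = c *\<^sub>C \<Phi> x) \<and>
    (\<forall>x\<in>S. \<Phi> (star x) = star (\<Phi> x))"


section \<open>The multiplier algebra\<close>

lemma bounded_clinearI:
  assumes "\<And>x y. f (x + y) = f x + f y" "\<And>c x. f (c *\<^sub>C x) = c *\<^sub>C f x"
    "\<And>x. norm (f x) \<le> norm x * K"
  shows "bounded_clinear f"
  unfolding bounded_clinear_def
proof
  have "f (r *\<^sub>R x) = r *\<^sub>R f x" for r x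
    using assms(2)[of "complex_of_real r" x] by (simp add: scaleC_of_real)
  then show "bounded_linear f"
    using assms by (intro bounded_linear_intro[where K = K]) auto
qed (use assms in auto)

lemma bounded_clinear_simps:
  assumes "bounded_clinear f"
  shows "f (x + y) = f x + f y" "f (c *\<^sub>C x) = c *\<^sub>C f x" "f 0 = 0" "f (- x) = - f x"
    "f (x - y) = f x - f y"
  using assms
  by (auto simp: bounded_clinear_def linear_simps intro: linear_simps)

lemma bounded_clinear_bounded:
  assumes "bounded_clinear f"
  obtains K where "\<And>x. norm (f x) \<le> norm x * K"
  using assms bounded_linear.bounded unfolding bounded_clinear_def by blast

lemma bounded_clinear_zero: "bounded_clinear (\<lambda>x. 0)"
  by (rule bounded_clinearI[where K = 0]) auto

lemma bounded_clinear_id: "bounded_clinear (\<lambda>x. x)"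
  by (rule bounded_clinearI[where K = 1]) auto

lemma bounded_clinear_comp:
  assumes "bounded_clinear f" "bounded_clinear g"
  shows "bounded_clinear (\<lambda>x. f (g x))"
  using assms unfolding bounded_clinear_def by (auto intro: bounded_linear_compose)

lemma bounded_clinear_add:
  assumes "bounded_clinear f" "bounded_clinear g"
  shows "bounded_clinear (\<lambda>x. f x + g x)"
  using assms unfolding bounded_clinear_def
  by (auto intro: bounded_linear_add simp: scaleC_add_right)

lemma bounded_clinear_minus:
  assumes "bounded_clinear f"
  shows "bounded_clinear (\<lambda>x. - f x)"
  using assms unfolding bounded_clinear_def
  by (auto intro: bounded_linear_minus)

lemma bounded_clinear_scaleC:
  assumes "bounded_clinear f"
  shows "bounded_clinear (\<lambda>x. c *\<^sub>C f x)"
proof -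
  obtain K where K: "\<And>x. norm (f x) \<le> norm x * K"
    using bounded_clinear_bounded[OF assms] by blast
  show ?thesis
  proof (rule bounded_clinearI[where K = "cmod c * K"])
    show "norm (c *\<^sub>C f x) \<le> norm x * (cmod c * K)" for x
      using mult_left_mono[OF K[of x], of "cmod c"] by (simp add: norm_scaleC ac_simps)
  qed (simp_all add: bounded_clinear_simps[OF assms] complex_vector.scale_left_commute
      scaleC_add_right)
qed

lemma norm_star: "norm (star x) = norm (x :: 'a::cstar_algebra)"
proof -
  have le: "norm y \<le> norm (star y)" for y :: 'a
  proof (cases "y = 0")
    case False
    have "norm y * norm y \<le> norm (star y) * norm y"
      using cstar_identity[of y] norm_mult_ineq[of "star y" y] by (simp add: power2_eq_square)
    then show ?thesis using False by simp
  qed simp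
  show ?thesis using le[of x] le[of "star x"] by (simp add: star_star)
qed

lemma bounded_clinear_star:
  fixes f :: "'a::cstar_algebra \<Rightarrow> 'a"
  assumes "bounded_clinear f"
  shows "bounded_clinear (\<lambda>x. star (f (star x)))"
proof -
  obtain K where K: "\<And>x. norm (f x) \<le> norm x * K"
    using bounded_clinear_bounded[OF assms] by blast
  show ?thesis
    by (rule bounded_clinearI[where K = K])
      (use K[of "star _"] in \<open>simp_all add: norm_star star_add star_scaleC bounded_clinear_simps[OF assms]\<close>)
qed

text \<open>
  The elements of \<open>M(A)\<close> are the double centralizers \<open>(L, R)\<close> of \<open>A\<close>, where \<open>L a = m a\<close>
  and \<open>R a = a m\<close> are left and right multiplication by the multiplier \<open>m\<close>.
\<close>

definition double_centralizer :: "('a::cstar_algebra \<Rightarrow> 'a) \<times> ('a \<Rightarrow> 'a) \<Rightarrow> bool"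
  where "double_centralizer = (\<lambda>(L, R).
    bounded_clinear L \<and> bounded_clinear R \<and>
    (\<forall>a b. L (a * b) = L a * b) \<and> (\<forall>a b. R (a * b) = a * R b) \<and>
    (\<forall>a b. R a * b = a * L b))"

typedef (overloaded) 'a multiplier =
  "{m :: ('a::cstar_algebra \<Rightarrow> 'a) \<times> ('a \<Rightarrow> 'a). double_centralizer m}"
  by (intro exI[where x = "(\<lambda>a. a, \<lambda>a. a)"])
    (simp add: double_centralizer_def bounded_clinear_id)

setup_lifting type_definition_multiplier

lift_definition mult_left :: "'a::cstar_algebra multiplier \<Rightarrow> 'a \<Rightarrow> 'a" is fst .

lift_definition mult_right :: "'a::cstar_algebra multiplier \<Rightarrow> 'a \<Rightarrow> 'a" is snd .

lemma star_eq_zero_simps: "star 0 = (0 :: 'a::star_algebra)" "star (- x) = - star (x :: 'a)"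
proof -
  show z: "star 0 = (0 :: 'a)" using star_add[of "0 :: 'a" 0] by simp
  show "star (- x) = - star x" using star_add[of x "- x"] z
    by (simp add: minus_unique)
qed

instantiation multiplier :: (cstar_algebra) "{star_algebra, monoid_mult}"
begin

lift_definition zero_multiplier :: "'a multiplier" is "(\<lambda>a. 0, \<lambda>a. 0)"
  by (simp add: double_centralizer_def bounded_clinear_zero)

lift_definition one_multiplier :: "'a multiplier" is "(\<lambda>a. a, \<lambda>a. a)"
  by (simp add: double_centralizer_def bounded_clinear_id)

lift_definition plus_multiplier :: "'a multiplier \<Rightarrow> 'a multiplier \<Rightarrow> 'a multiplier"
  is "\<lambda>(L, R) (L', R'). (\<lambda>a. L a + L' a, \<lambda>a. R a + R' a)"
  by (auto simp: double_centralizer_def bounded_clinear_add algebra_simps)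

lift_definition uminus_multiplier :: "'a multiplier \<Rightarrow> 'a multiplier"
  is "\<lambda>(L, R). (\<lambda>a. - L a, \<lambda>a. - R a)"
  by (auto simp: double_centralizer_def bounded_clinear_minus)

definition minus_multiplier :: "'a multiplier \<Rightarrow> 'a multiplier \<Rightarrow> 'a multiplier"
  where "minus_multiplier m m' = m + - m'"

lift_definition scaleC_multiplier :: "complex \<Rightarrow> 'a multiplier \<Rightarrow> 'a multiplier"
  is "\<lambda>c (L, R). (\<lambda>a. c *\<^sub>C L a, \<lambda>a. c *\<^sub>C R a)"
  by (auto simp: double_centralizer_def bounded_clinear_scaleC mult_scaleC_left mult_scaleC_right)

definition scaleR_multiplier :: "real \<Rightarrow> 'a multiplier \<Rightarrow> 'a multiplier"
  where "scaleR_multiplier r m = complex_of_real r *\<^sub>C m"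

lift_definition times_multiplier :: "'a multiplier \<Rightarrow> 'a multiplier \<Rightarrow> 'a multiplier"
  is "\<lambda>(L, R) (L', R'). (\<lambda>a. L (L' a), \<lambda>a. R' (R a))"
  by (auto simp: double_centralizer_def bounded_clinear_comp)

lift_definition star_multiplier :: "'a multiplier \<Rightarrow> 'a multiplier"
  is "\<lambda>(L, R). (\<lambda>a. star (R (star a)), \<lambda>a. star (L (star a)))"
  apply (auto simp: double_centralizer_def bounded_clinear_star star_mult star_star)
  by (metis star_mult star_star)

instance
proof
  fix m m' m'' :: "'a multiplier" and c d :: complex and r s :: real
  show "m + m' + m'' = m + (m' + m'')"
    by transfer (auto simp: add.assoc)
  show "m + m' = m' + m"
    by transfer (auto simp: add.commute)
  show "0 + m = m"
    by transfer auto
  show "- m + m = 0"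
    by transfer auto
  show "m - m' = m + - m'"
    by (simp add: minus_multiplier_def)
  show "m * m' * m'' = m * (m' * m'')"
    by transfer auto
  show "1 * m = m" "m * 1 = m"
    by (transfer, auto)+
  show "(m + m') * m'' = m * m'' + m' * m''" "m * (m' + m'') = m * m' + m * m''"
    by (transfer, auto simp: double_centralizer_def bounded_clinear_simps)+
  show sc: "c *\<^sub>C (m + m') = c *\<^sub>C m + c *\<^sub>C m'" for c and m m' :: "'a multiplier"
    by transfer (auto simp: scaleC_add_right)
  show sc': "(c + d) *\<^sub>C m = c *\<^sub>C m + d *\<^sub>C m" for c d and m :: "'a multiplier"
    by transfer (auto simp: scaleC_add_left)
  show sc'': "c *\<^sub>C d *\<^sub>C m = (c * d) *\<^sub>C m" for c d and m :: "'a multiplier"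
    by transfer (auto simp: scaleC_scaleC)
  show "complex_of_real r *\<^sub>C m = r *\<^sub>R m"
    by (simp add: scaleR_multiplier_def)
  show "r *\<^sub>R (m + m') = r *\<^sub>R m + r *\<^sub>R m'" "(r + s) *\<^sub>R m = r *\<^sub>R m + s *\<^sub>R m"
    "r *\<^sub>R s *\<^sub>R m = (r * s) *\<^sub>R m"
    by (simp_all add: scaleR_multiplier_def sc sc' sc'')
  have "1 *\<^sub>C m = m"
    by transfer auto
  then show "1 *\<^sub>R m = m"
    by (simp add: scaleR_multiplier_def)
  show "c *\<^sub>C m * m' = c *\<^sub>C (m * m')" "m * c *\<^sub>C m' = c *\<^sub>C (m * m')"
    by (transfer, auto simp: double_centralizer_def bounded_clinear_simps)+
  show "star (m + m') = star m + star m'"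
    by transfer (auto simp: star_add)
  show "star (c *\<^sub>C m) = cnj c *\<^sub>C star m"
    by transfer (auto simp: star_scaleC)
  show "star (m * m') = star m' * star m"
    by transfer (auto simp: star_star)
  show "star (star m) = m"
    by transfer (auto simp: star_star)
qed

end


section \<open>Hilbert modules and imprimitivity bimodules\<close>

text \<open>
  A Hilbert module is modelled on a Banach space type whose norm is the one induced by the
  inner product. Definiteness of the inner product is contained in this norm condition.
\<close>

locale left_hilbert_module =
  fixes act :: "'a::cstar_algebra \<Rightarrow> 'x::{complex_normed_vector, banach} \<Rightarrow> 'x"
    and ip :: "'x \<Rightarrow> 'x \<Rightarrow> 'a"
  assumes act_add_left: "act (a + b) x = act a x + act b x"
    and act_add_right: "act a (x + y) = act a x + act a y"
    and act_scaleC_left: "act (c *\<^sub>C a) x = c *\<^sub>C act a x"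
    and act_scaleC_right: "act a (c *\<^sub>C x) = c *\<^sub>C act a x"
    and act_mult: "act (a * b) x = act a (act b x)"
    and ip_add_left: "ip (x + y) z = ip x z + ip y z"
    and ip_scaleC_left: "ip (c *\<^sub>C x) y = c *\<^sub>C ip x y"
    and ip_act_left: "ip (act a x) y = a * ip x y"
    and ip_star: "star (ip x y) = ip y x"
    and ip_positive: "cstar_positive (ip x x)"
    and norm_eq_ip: "norm x = sqrt (norm (ip x x))"

locale right_hilbert_module =
  fixes act :: "'x::{complex_normed_vector, banach} \<Rightarrow> 'b::cstar_algebra \<Rightarrow> 'x"
    and ip :: "'x \<Rightarrow> 'x \<Rightarrow> 'b"
  assumes act_add_left: "act (x + y) b = act x b + act y b"
    and act_add_right: "act x (a + b) = act x a + act x b"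
    and act_scaleC_left: "act (c *\<^sub>C x) b = c *\<^sub>C act x b"
    and act_scaleC_right: "act x (c *\<^sub>C b) = c *\<^sub>C act x b"
    and act_mult: "act x (a * b) = act (act x a) b"
    and ip_add_right: "ip x (y + z) = ip x y + ip x z"
    and ip_scaleC_right: "ip x (c *\<^sub>C y) = c *\<^sub>C ip x y"
    and ip_act_right: "ip x (act y b) = ip x y * b"
    and ip_star: "star (ip x y) = ip y x"
    and ip_positive: "cstar_positive (ip x x)"
    and norm_eq_ip: "norm x = sqrt (norm (ip x x))"

definition full_ip :: "('x \<Rightarrow> 'x \<Rightarrow> 'a::cstar_algebra) \<Rightarrow> bool"
  where "full_ip ip \<longleftrightarrow> closure (complex_vector.span {ip x y |x y. True}) = UNIV"

text \<open>
  Both Hilbert modules below live on the same normed space: in an imprimitivity bimodule the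
  norms induced by the two inner products always coincide.
\<close>

locale imprimitivity_bimodule =
  A: left_hilbert_module actA ipA + B: right_hilbert_module actB ipB
  for actA :: "'a::cstar_algebra \<Rightarrow> 'x::{complex_normed_vector, banach} \<Rightarrow> 'x"
    and ipA :: "'x \<Rightarrow> 'x \<Rightarrow> 'a"
    and actB :: "'x \<Rightarrow> 'b::cstar_algebra \<Rightarrow> 'x"
    and ipB :: "'x \<Rightarrow> 'x \<Rightarrow> 'b" +
  assumes full_A: "full_ip ipA"
    and full_B: "full_ip ipB"
    and ip_compat: "actA (ipA x y) z = actB x (ipB y z)"

text \<open>
  The canonical extensions of the actions to the multiplier algebras: \<open>m (a x) = (m a) x\<close> and
  \<open>(x b) m = x (b m)\<close>. They determine the operator uniquely, since the products \<open>a x\<close>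
  (resp. \<open>x b\<close>) span a dense subspace of a Hilbert module.
\<close>

definition left_mult_action ::
    "('a::cstar_algebra \<Rightarrow> 'x::complex_normed_vector \<Rightarrow> 'x) \<Rightarrow> 'a multiplier \<Rightarrow> 'x \<Rightarrow> 'x"
  where "left_mult_action act m =
    (THE T. bounded_clinear T \<and> (\<forall>a x. T (act a x) = act (mult_left m a) x))"

definition right_mult_action ::
    "('x::complex_normed_vector \<Rightarrow> 'b::cstar_algebra \<Rightarrow> 'x) \<Rightarrow> 'b multiplier \<Rightarrow> 'x \<Rightarrow> 'x"
  where "right_mult_action act m =
    (THE T. bounded_clinear T \<and> (\<forall>x b. T (act x b) = act x (mult_right m b)))"

definition preserves_ip :: "('x \<Rightarrow> 'x \<Rightarrow> 'a) \<Rightarrow> ('x \<Rightarrow> 'x) \<Rightarrow> bool"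
  where "preserves_ip ip T \<longleftrightarrow> (\<forall>x y. ip (T x) (T y) = ip x y)"

end

theory Submission
  imports Defs
begin

text \<open>
  A bijection \<open>T\<close> preserving both inner products is linear over one algebra iff it is linear over
  the other, because the inner products are linked by \<open>\<langle>x, y\<rangle>\<^sub>A z = x \<langle>y, z\<rangle>\<^sub>B\<close>. It remains to identify
  the bounded bimodule maps with \<open>Z(M(A))\<close>. A central multiplier \<open>u\<close> gives the map determined by
  \<open>\<langle>T x, y\<rangle>\<^sub>A = u \<langle>x, y\<rangle>\<^sub>A\<close>. Conversely \<open>\<Sum> \<langle>y\<^sub>i, z\<^sub>i\<rangle>\<^sub>A \<mapsto> \<Sum> \<langle>T y\<^sub>i, z\<^sub>i\<rangle>\<^sub>A\<close> extends to \<open>A\<close>,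
  since \<open>A\<close> acts isometrically on \<open>X\<close>, and defines a central multiplier. The adjoint of \<open>T\<close> for either
  inner product belongs to \<open>u\<^sup>*\<close>, so preserving the inner products means that \<open>u\<close> is unitary. The
  notion of a bimodule map is symmetric in \<open>A\<close> and \<open>B\<close>, so \<open>Z(M(B))\<close> is obtained by applying this to \<open>X\<close>
  as a bimodule over the opposite algebras. No functional calculus is used: approximate units come
  from resolvents \<open>(1 + i s h)\<^sup>-\<^sup>1\<close> of selfadjoint elements.
\<close>

section \<open>Local approximate units\<close>

lemma norm_mult_star: "norm (x * star x) = (norm x)\<^sup>2" for x :: "'a::cstar_algebra"
  using cstar_identity[of "star x"] by (simp add: star_star norm_star)

text \<open>The choice \<open>b = star (c - d)\<close> and the C*-identity annihilate
  \<open>c - d\<close>; this allows cancellation without a unit.\<close>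

lemma eq_if_mult_left_eq:
  fixes c d :: "'a::cstar_algebra"
  assumes "\<And>b. b * c = b * d"
  shows "c = d"
proof -
  have "star (c - d) * (c - d) = 0"
    using assms by (simp add: right_diff_distrib)
  then show ?thesis
    using cstar_identity[of "c - d"] by simp
qed

lemma eq_if_mult_right_eq:
  fixes c d :: "'a::cstar_algebra"
  assumes "\<And>b. c * b = d * b"
  shows "c = d"
proof -
  have "(c - d) * star (c - d) = 0"
    using assms by (simp add: left_diff_distrib)
  then show ?thesis
    using norm_mult_star[of "c - d"] by simp
qed

section \<open>Resolvents of selfadjoint elements\<close>

lemma norm_minus_scaleC_selfadjoint:
  fixes h a :: "'a::cstar_algebra"
  assumes "star h = h"
  shows "norm (a - (\<i> * of_real s) *\<^sub>C (h * a)) = norm (a + (\<i> * of_real s) *\<^sub>C (h * a))"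
proof -
  let ?x = "\<lambda>c. a + c *\<^sub>C (h * a)"
  \<comment> \<open>Formally \<open>1 + i s h\<close> and \<open>1 - i s h\<close> are commuting
    adjoints of each other, so both signs give \<open>star a (1 + s^2 h^2) a\<close>, and the
    C*-identity compares the norms.\<close>
  have *: "star (?x c) * ?x c = star a * a + (s\<^sup>2) *\<^sub>R (star a * (h * (h * a)))"
    if "c = \<i> * of_real s \<or> c = - (\<i> * of_real s)" for c
  proof -
    have "cnj c = - c" "cnj c * c = of_real (s\<^sup>2)"
      using that by (auto simp: complex_eq_iff power2_eq_square)
    moreover have "star (?x c) * ?x c = star a * a + c *\<^sub>C (star a * (h * a))
        + cnj c *\<^sub>C (star a * (h * a)) + (cnj c * c) *\<^sub>C (star a * (h * (h * a)))"
      by (simp add: star_add star_scaleC star_mult assms distrib_left distrib_right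
          mult_scaleC_left mult_scaleC_right scaleC_add_right scaleC_scaleC mult.assoc
          mult.commute[of c "cnj c"])
    ultimately show ?thesis
      by (simp add: scaleC_of_real del: of_real_power)
  qed
  have "(norm (?x (- (\<i> * of_real s))))\<^sup>2 = (norm (?x (\<i> * of_real s)))\<^sup>2"
    unfolding cstar_identity[symmetric] by (simp only: * simp_thms)
  then show ?thesis
    by simp
qed

text \<open>Both bounds come from writing \<open>2 a\<close> and \<open>2 i s h a\<close> as the sum and the difference of the
  two vectors \<open>a \<plusminus> i s h a\<close>, which have the same norm.\<close>

lemma selfadjoint_resolvent_bounds:
  fixes h a :: "'a::cstar_algebra"
  assumes "star h = h" and d: "a + (\<i> * of_real s) *\<^sub>C (h * a) = d"
  shows "norm a \<le> norm d" "\<bar>s\<bar> * norm (h * a) \<le> norm d"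
proof -
  let ?c = "(\<i> * of_real s) *\<^sub>C (h * a)"
  have n: "norm (a - ?c) = norm d"
    using norm_minus_scaleC_selfadjoint[OF assms(1), of a s] d by simp
  have "2 *\<^sub>R a = d + (a - ?c)" "2 *\<^sub>R ?c = d - (a - ?c)"
    using d by (auto simp: scaleR_2)
  then have "2 * norm a \<le> norm d + norm d" "2 * norm ?c \<le> norm d + norm d"
    using n norm_triangle_ineq[of d "a - ?c"] norm_triangle_ineq4[of d "a - ?c"]
    by (metis norm_scaleR abs_numeral)+
  then show "norm a \<le> norm d" "\<bar>s\<bar> * norm (h * a) \<le> norm d"
    by (auto simp: norm_scaleC norm_mult)
qed

lemma selfadjoint_resolvent_unique:
  fixes h a :: "'a::cstar_algebra"
  assumes "star h = h"
    and "a + (\<i> * of_real s) *\<^sub>C (h * a) = a' + (\<i> * of_real s) *\<^sub>C (h * a')"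
  shows "a = a'"
proof -
  have "(a - a') + (\<i> * of_real s) *\<^sub>C (h * (a - a')) = 0"
    using assms(2) by (simp add: right_diff_distrib complex_vector.scale_right_diff_distrib
        algebra_simps)
  from selfadjoint_resolvent_bounds(1)[OF assms(1) this] show ?thesis
    by simp
qed

text \<open>Continuity method: the solution operator \<open>R\<close> at \<open>s\<close> is
  nonexpansive, so the equation at \<open>s + t\<close> becomes a fixed point problem for a
  contraction with constant 1/2.\<close>

lemma selfadjoint_resolvent_step:
  fixes h :: "'a::cstar_algebra"
  assumes h: "star h = h" and t: "\<bar>t\<bar> * norm h \<le> 1 / 2"
    and ex: "\<And>d. \<exists>a. a + (\<i> * of_real s) *\<^sub>C (h * a) = d"
  shows "\<exists>a. a + (\<i> * of_real (s + t)) *\<^sub>C (h * a) = d"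
proof -
  from ex obtain R where R: "\<And>d. R d + (\<i> * of_real s) *\<^sub>C (h * R d) = d"
    by metis
  have R_diff: "norm (R d - R d') \<le> norm (d - d')" for d d'
    by (rule selfadjoint_resolvent_bounds(1)[OF h, of _ s])
      (use R[of d] R[of d'] in \<open>simp add: right_diff_distrib
        complex_vector.scale_right_diff_distrib algebra_simps\<close>)
  let ?f = "\<lambda>a. R (d - (\<i> * of_real t) *\<^sub>C (h * a))"
  have "dist (?f a) (?f b) \<le> 1 / 2 * dist a b" for a b
  proof -
    have "dist (?f a) (?f b) \<le> norm ((\<i> * of_real t) *\<^sub>C (h * (b - a)))"
      using R_diff[of "d - (\<i> * of_real t) *\<^sub>C (h * a)" "d - (\<i> * of_real t) *\<^sub>C (h * b)"]
      by (simp add: dist_norm right_diff_distrib complex_vector.scale_right_diff_distrib)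
    also have "\<dots> \<le> \<bar>t\<bar> * (norm h * norm (b - a))"
      by (simp add: norm_scaleC norm_mult mult_left_mono norm_mult_ineq)
    also have "\<dots> \<le> 1 / 2 * dist a b"
      using mult_right_mono[OF t, of "norm (b - a)"]
      by (simp add: dist_norm norm_minus_commute mult.assoc)
    finally show ?thesis .
  qed
  then have "\<exists>!a. ?f a = a"
    using Banach_fix[of UNIV "1 / 2" ?f] complete_UNIV by auto
  then obtain a where "?f a = a"
    by blast
  with R[of "d - (\<i> * of_real t) *\<^sub>C (h * a)"]
  have "a + (\<i> * of_real s) *\<^sub>C (h * a) = d - (\<i> * of_real t) *\<^sub>C (h * a)"
    by simp
  then have "a + (\<i> * of_real (s + t)) *\<^sub>C (h * a) = d"
    by (simp add: distrib_left scaleC_add_left algebra_simps)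
  then show ?thesis
    by blast
qed

lemma selfadjoint_resolvent_exists:
  fixes h :: "'a::cstar_algebra"
  assumes h: "star h = h"
  shows "\<exists>a. a + (\<i> * of_real s) *\<^sub>C (h * a) = d"
proof -
  obtain n :: nat where n: "2 * \<bar>s\<bar> * norm h < real n"
    using reals_Archimedean2 by blast
  \<comment> \<open>Start at parameter 0, where the equation is trivial, and reach \<open>s\<close>
    in \<open>n\<close> steps short enough for the contraction.\<close>
  define t where "t = s / real n"
  have n0: "real n > 0"
    using n by (smt (verit) mult_nonneg_nonneg norm_ge_zero abs_ge_zero)
  then have t: "\<bar>t\<bar> * norm h \<le> 1 / 2"
    using n by (simp add: t_def field_simps)
  have "\<exists>a. a + (\<i> * of_real (real k * t)) *\<^sub>C (h * a) = d" for k d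
  proof (induction k arbitrary: d)
    case (Suc k)
    show ?case
      using selfadjoint_resolvent_step[OF h t Suc.IH] by (simp add: distrib_right add.commute)
  qed auto
  from this[of n] show ?thesis
    using n0 by (simp add: t_def)
qed

text \<open>The local unit is \<open>i s h (1 + i s h)\<^sup>-\<^sup>1\<close>, so that the remainder \<open>c\<close> is \<open>h (1 + i s h)\<^sup>-\<^sup>1\<close>.\<close>

lemma selfadjoint_local_unit:
  fixes h :: "'a::cstar_algebra"
  assumes h: "star h = h" and s: "s > 0"
  obtains e where "norm e \<le> 1" "norm (h - e * h) \<le> 1 / s"
proof -
  let ?i = "\<i> * complex_of_real s"
  obtain c where c: "c + ?i *\<^sub>C (h * c) = h"
    using selfadjoint_resolvent_exists[OF h] by blast
  \<comment> \<open>Both products solve the resolvent equation with right-hand side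
    \<open>h * h\<close>.\<close>
  have comm: "h * c = c * h"
  proof (rule selfadjoint_resolvent_unique[OF h, of _ s])
    show "h * c + ?i *\<^sub>C (h * (h * c)) = c * h + ?i *\<^sub>C (h * (c * h))"
      using arg_cong[OF c, of "\<lambda>z. h * z"] arg_cong[OF c, of "\<lambda>z. z * h"]
      by (simp add: distrib_left distrib_right mult_scaleC_left mult_scaleC_right mult.assoc)
  qed
  obtain a where a: "a + ?i *\<^sub>C (h * a) = star c"
    using selfadjoint_resolvent_exists[OF h] by blast
  \<comment> \<open>Both solve the equation with right-hand side \<open>h * star c\<close>. The
    bound on \<open>h * a\<close> then reads \<open>s ||c||^2 \<le> ||c||\<close>.\<close>
  have ca: "c * star c = h * a"
  proof (rule selfadjoint_resolvent_unique[OF h, of _ s])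
    show "c * star c + ?i *\<^sub>C (h * (c * star c)) = h * a + ?i *\<^sub>C (h * (h * a))"
      using arg_cong[OF c, of "\<lambda>z. z * star c"] arg_cong[OF a, of "\<lambda>z. h * z"]
      by (simp add: distrib_left distrib_right mult_scaleC_left mult_scaleC_right mult.assoc)
  qed
  have "s * (norm c)\<^sup>2 \<le> norm c"
    using selfadjoint_resolvent_bounds(2)[OF h a] s
    by (simp add: norm_mult_star norm_star flip: ca)
  then have le: "s * norm c \<le> 1"
    by (cases "c = 0") (simp_all add: power2_eq_square)
  show thesis
  proof (rule that)
    show "norm (?i *\<^sub>C c) \<le> 1"
      using le s by (simp add: norm_scaleC norm_mult)
    have "h - (?i *\<^sub>C c) * h = c"
      using c comm by (metis mult_scaleC_left add_diff_cancel_right')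
    then show "norm (h - (?i *\<^sub>C c) * h) \<le> 1 / s"
      using le s by (simp add: pos_le_divide_eq mult.commute)
  qed
qed


section \<open>Hilbert modules\<close>

text \<open>The differences of \<open>g\<close> are dominated by those of \<open>f\<close>, so
  \<open>g\<close> is Cauchy. This extends solutions of an equation from approximating data to their
  limit.\<close>

lemma LIMSEQ_if_norm_diff_le:
  fixes f :: "nat \<Rightarrow> 'a::real_normed_vector" and g :: "nat \<Rightarrow> 'b::banach"
  assumes "f \<longlonglongrightarrow> l" "\<And>m n. norm (g m - g n) \<le> K * norm (f m - f n)"
  obtains l' where "g \<longlonglongrightarrow> l'"
proof -
  have "Cauchy g"
  proof (rule CauchyI)
    fix r :: real
    assume "r > 0"
    \<comment> \<open>\<open>K\<close> may be zero or negative; \<open>\<bar>K\<bar> + 1\<close> is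
      a safe divisor.\<close>
    then have "r / (\<bar>K\<bar> + 1) > 0"
      by simp
    with LIMSEQ_imp_Cauchy[OF assms(1)] obtain M where
      M: "\<forall>m\<ge>M. \<forall>n\<ge>M. norm (f m - f n) < r / (\<bar>K\<bar> + 1)"
      using CauchyD by blast
    show "\<exists>M. \<forall>m\<ge>M. \<forall>n\<ge>M. norm (g m - g n) < r"
    proof (intro exI allI impI)
      fix m n
      assume "m \<ge> M" "n \<ge> M"
      with M have "norm (f m - f n) < r / (\<bar>K\<bar> + 1)"
        by blast
      then have "(\<bar>K\<bar> + 1) * norm (f m - f n) < r"
        by (simp add: pos_less_divide_eq mult.commute)
      moreover have "K * norm (f m - f n) \<le> (\<bar>K\<bar> + 1) * norm (f m - f n)"
        by (intro mult_right_mono) auto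
      ultimately show "norm (g m - g n) < r"
        using assms(2)[of m n] by linarith
    qed
  qed
  then show thesis
    using that Cauchy_convergent_iff convergent_def by blast
qed

context left_hilbert_module
begin

section \<open>Boundedness of the inner product and of the action\<close>

lemma ip_add_right: "ip x (y + z) = ip x y + ip x z"
  by (metis ip_star ip_add_left star_add)

lemma ip_scaleC_right: "ip x (c *\<^sub>C y) = cnj c *\<^sub>C ip x y"
  by (metis ip_star ip_scaleC_left star_scaleC)

lemma ip_act_right: "ip x (act a y) = ip x y * star a"
  by (metis ip_star ip_act_left star_mult)

lemma norm_ip_self: "norm (ip x x) = (norm x)\<^sup>2"
  by (simp add: norm_eq_ip)

lemma norm_ip_add_le: "norm (ip x y + ip y x) \<le> (norm x + norm y)\<^sup>2"
proof -
  have m: "ip (- z) w = - ip z w" "ip w (- z) = - ip w z" for z w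
    using ip_scaleC_left[of "-1" z w] ip_scaleC_right[of w "-1" z] by simp_all
  \<comment> \<open>Polarization leaves only diagonal values, whose norms are squares of vector
    norms.\<close>
  have "2 *\<^sub>R (ip x y + ip y x) = ip (x + y) (x + y) - ip (x + (- y)) (x + (- y))"
    unfolding ip_add_left ip_add_right m scaleR_2 by simp
  then have "2 * norm (ip x y + ip y x) \<le> norm (ip (x + y) (x + y)) + norm (ip (x - y) (x - y))"
    by (metis norm_scaleR abs_numeral norm_triangle_ineq4 diff_conv_add_uminus)
  also have "\<dots> = (norm (x + y))\<^sup>2 + (norm (x - y))\<^sup>2"
    by (simp add: norm_ip_self)
  also have "\<dots> \<le> (norm x + norm y)\<^sup>2 + (norm x + norm y)\<^sup>2"
    by (intro add_mono power_mono norm_triangle_ineq norm_triangle_ineq4) auto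
  finally show ?thesis
    by simp
qed

text \<open>The factor 4 is what polarization gives; it spares the order structure of the algebra.\<close>

lemma norm_ip_le: "norm (ip x y) \<le> 4 * norm x * norm y"
proof -
  have le: "norm (ip x y) \<le> (norm x + norm y)\<^sup>2" for x y
  proof -
    \<comment> \<open>Replacing \<open>y\<close> by \<open>\<i> *\<^sub>C y\<close> produces the
      difference \<open>ip x y - ip y x\<close>, so symmetric sums suffice.\<close>
    have "2 *\<^sub>R ip x y = (ip x y + ip y x) + \<i> *\<^sub>C (ip x (\<i> *\<^sub>C y) + ip (\<i> *\<^sub>C y) x)"
      by (simp add: ip_scaleC_left ip_scaleC_right scaleC_add_right scaleC_scaleC scaleR_2
          complex_vector.scale_right_diff_distrib)
    then have "2 * norm (ip x y) \<le>
        norm (ip x y + ip y x) + norm (\<i> *\<^sub>C (ip x (\<i> *\<^sub>C y) + ip (\<i> *\<^sub>C y) x))"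
      by (metis norm_scaleR abs_numeral norm_triangle_ineq)
    also have "\<dots> \<le> (norm x + norm y)\<^sup>2 + (norm x + norm y)\<^sup>2"
      using norm_ip_add_le[of x y] norm_ip_add_le[of x "\<i> *\<^sub>C y"] by (simp add: norm_scaleC)
    finally show ?thesis
      by simp
  qed
  have sc: "ip (r *\<^sub>R x) (t *\<^sub>R y) = (r * t) *\<^sub>R ip x y" for r t x y
    by (simp add: scaleC_of_real[symmetric] ip_scaleC_left ip_scaleC_right scaleC_scaleC)
  \<comment> \<open>Rescaling makes the bound homogeneous: on vectors of norm at most 1 it is
    \<open>(1 + 1)^2 = 4\<close>.\<close>
  have "ip x y = (norm x * norm y) *\<^sub>R ip (sgn x) (sgn y)"
  proof (cases "x = 0 \<or> y = 0")
    case True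
    then show ?thesis
      using sc[of 0 x 1 y] sc[of 1 x 0 y] by auto
  next
    case False
    then show ?thesis
      by (simp add: sgn_div_norm sc field_simps)
  qed
  moreover have "norm (ip (sgn x) (sgn y)) \<le> 4"
    by (rule order_trans[OF le]) (auto simp: norm_sgn power2_eq_square)
  ultimately show ?thesis
    using mult_left_mono[of "norm (ip (sgn x) (sgn y))" 4 "norm x * norm y"]
    by (simp add: ac_simps)
qed

text \<open>The square of the left side is the norm of \<open>a * ip x x * star a\<close>;
  submultiplicativity and \<open>norm_star\<close> give the constant 1.\<close>

lemma norm_act_le: "norm (act a x) \<le> norm a * norm x"
proof -
  have "(norm (act a x))\<^sup>2 = norm (a * (ip x x * star a))"
    by (simp add: norm_ip_self[symmetric] ip_act_left ip_act_right mult.assoc)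
  also have "\<dots> \<le> norm a * (norm (ip x x) * norm (star a))"
    by (meson norm_mult_ineq order_trans mult_left_mono norm_ge_zero)
  also have "\<dots> = (norm a * norm x)\<^sup>2"
    by (simp add: norm_ip_self norm_star power2_eq_square)
  finally show ?thesis
    by (rule power2_le_imp_le) simp
qed

lemma bounded_bilinear_act: "bounded_bilinear act"
proof
  show "\<exists>K. \<forall>a x. norm (act a x) \<le> norm a * norm x * K"
    using norm_act_le by (intro exI[of _ 1]) simp
qed (simp_all add: act_add_left act_add_right act_scaleC_left act_scaleC_right
    flip: scaleC_of_real)

lemma bounded_bilinear_ip: "bounded_bilinear ip"
proof
  show "\<exists>K. \<forall>x y. norm (ip x y) \<le> norm x * norm y * K"
    using norm_ip_le by (intro exI[of _ 4]) (simp add: ac_simps)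
qed (simp_all add: ip_add_left ip_add_right ip_scaleC_left ip_scaleC_right
    flip: scaleC_of_real)

lemmas act_diff_left = bounded_bilinear.diff_left[OF bounded_bilinear_act]
lemmas ip_diff_left = bounded_bilinear.diff_left[OF bounded_bilinear_ip]
lemmas ip_diff_right = bounded_bilinear.diff_right[OF bounded_bilinear_ip]

lemma eq_if_ip_eq:
  assumes "\<And>y. ip x y = ip x' y"
  shows "x = x'"
proof -
  have "ip (x - x') (x - x') = 0"
    using assms by (simp add: ip_diff_left)
  then show ?thesis
    using norm_ip_self[of "x - x'"] by simp
qed

lemma eq_if_ip_eq_right:
  assumes "\<And>y. ip y x = ip y x'"
  shows "x = x'"
  using assms by (intro eq_if_ip_eq) (metis ip_star)

section \<open>Approximate units acting on the module\<close>

lemma local_unit: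
  obtains e where "norm e \<le> 1" "norm (x - act e x) \<le> sqrt (2 / real (Suc n))"
proof -
  let ?h = "ip x x"
  obtain e where e: "norm e \<le> 1" "norm (?h - e * ?h) \<le> 1 / real (Suc n)"
    using selfadjoint_local_unit[of ?h "real (Suc n)"] ip_star by auto
  \<comment> \<open>\<open>ip (x - e x) (x - e x)\<close> is \<open>(1 - e) h (1 - star e)\<close>,
    so a left local unit for \<open>h\<close> in the algebra is one for \<open>x\<close>.\<close>
  have "(norm (x - act e x))\<^sup>2 = norm ((?h - e * ?h) - (?h - e * ?h) * star e)"
    by (simp add: norm_ip_self[symmetric] ip_diff_left ip_diff_right ip_act_left ip_act_right
        algebra_simps)
  also have "\<dots> \<le> norm (?h - e * ?h) + norm (?h - e * ?h) * norm e"
    by (metis norm_triangle_ineq4 norm_mult_ineq norm_star add_left_mono order_trans)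
  also have "\<dots> \<le> 1 / real (Suc n) + 1 / real (Suc n)"
    using e mult_mono[OF e(2,1)] by (intro add_mono) auto
  finally have "norm (x - act e x) \<le> sqrt (2 / real (Suc n))"
    by (intro real_le_rsqrt) (simp add: field_simps)
  with e(1) show thesis
    by (rule that)
qed

lemma act_approx:
  obtains e where "(\<lambda>n. act (e n) x) \<longlonglongrightarrow> x"
proof -
  have "\<exists>e. norm (x - act e x) \<le> sqrt (2 / real (Suc n))" for n
    using local_unit by metis
  then obtain e where e: "\<And>n. norm (x - act (e n) x) \<le> sqrt (2 / real (Suc n))"
    by metis
  have "(\<lambda>n. sqrt (2 * inverse (real (Suc n)))) \<longlonglongrightarrow> sqrt (2 * 0)"
    by (intro tendsto_intros LIMSEQ_inverse_real_of_nat)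
  then have "(\<lambda>n. sqrt (2 / real (Suc n))) \<longlonglongrightarrow> 0"
    by (simp add: divide_inverse)
  then have "(\<lambda>n. act (e n) x - x) \<longlonglongrightarrow> 0"
    by (rule Lim_null_comparison[rotated]) (use e in \<open>auto simp: norm_minus_commute\<close>)
  then show thesis
    using that LIM_zero_iff by blast
qed

text \<open>By \<open>act_approx\<close> every vector is a limit of products \<open>act a x\<close>.
  This is the uniqueness behind the description \<open>left_mult_action\<close>.\<close>

lemma eq_if_eq_on_act:
  assumes "bounded_clinear S" "bounded_clinear T" "\<And>a x. S (act a x) = T (act a x)"
  shows "S = T"
proof
  fix x
  obtain e where e: "(\<lambda>n. act (e n) x) \<longlonglongrightarrow> x"
    by (rule act_approx)
  have "bounded_linear S" "bounded_linear T"
    using assms by (auto simp: bounded_clinear_def)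
  then have "(\<lambda>n. S (act (e n) x)) \<longlonglongrightarrow> S x" "(\<lambda>n. T (act (e n) x)) \<longlonglongrightarrow> T x"
    using e by (auto intro: bounded_linear.tendsto)
  then show "S x = T x"
    using assms(3) LIMSEQ_unique by auto
qed

text \<open>The relation \<open>\<langle>z, y\<rangle> = L \<langle>x, y\<rangle>\<close> forces \<open>\<parallel>z\<parallel> \<le> 4 K \<parallel>x\<parallel>\<close>, so it can be solved for \<open>z\<close>
  first on products \<open>a x\<close> and then in the limit.\<close>

lemma left_centralizer_action_exists:
  assumes L: "bounded_clinear L" and mult: "\<And>a b. L (a * b) = L a * b"
  obtains T where "bounded_clinear T" "\<And>x y. ip (T x) y = L (ip x y)"
proof -
  obtain K where K: "K > 0" "\<And>a. norm (L a) \<le> norm a * K"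
    using L bounded_linear.pos_bounded unfolding bounded_clinear_def by blast
  have bound: "norm z \<le> 4 * K * norm x" if z: "\<And>y. ip z y = L (ip x y)" for z x
  proof -
    \<comment> \<open>The relation at \<open>y = z\<close> gives
      \<open>ip z z = L (ip x z)\<close>.\<close>
    have "(norm z)\<^sup>2 \<le> norm (ip x z) * K"
      using K(2)[of "ip x z"] by (simp add: norm_ip_self[symmetric] z)
    also have "\<dots> \<le> 4 * norm x * norm z * K"
      using norm_ip_le K(1) by (intro mult_right_mono) auto
    finally show ?thesis
      by (cases "z = 0") (use K(1) in \<open>simp_all add: power2_eq_square ac_simps\<close>)
  qed
  have "\<exists>z. \<forall>y. ip z y = L (ip x y)" for x
  proof -
    obtain e where e: "(\<lambda>n. act (e n) x) \<longlonglongrightarrow> x"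
      by (rule act_approx)
    let ?z = "\<lambda>n. act (L (e n)) x"
    have ip_z: "ip (?z n) y = L (ip (act (e n) x) y)" for n y
      by (simp add: ip_act_left mult)
    have diff: "norm (?z m - ?z n) \<le> 4 * K * norm (act (e m) x - act (e n) x)" for m n
      by (rule bound) (simp add: ip_diff_left ip_z bounded_clinear_simps[OF L])
    obtain z where z: "?z \<longlonglongrightarrow> z"
      by (rule LIMSEQ_if_norm_diff_le[OF e diff])
    have "ip z y = L (ip x y)" for y
    proof (rule LIMSEQ_unique)
      show "(\<lambda>n. ip (?z n) y) \<longlonglongrightarrow> ip z y"
        by (intro bounded_bilinear.tendsto[OF bounded_bilinear_ip] z tendsto_const)
      show "(\<lambda>n. ip (?z n) y) \<longlonglongrightarrow> L (ip x y)"
        unfolding ip_z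
        by (intro bounded_linear.tendsto[of L] bounded_bilinear.tendsto[OF bounded_bilinear_ip]
            e tendsto_const) (use L in \<open>simp add: bounded_clinear_def\<close>)
    qed
    then show ?thesis
      by blast
  qed
  then obtain T where T: "\<And>x y. ip (T x) y = L (ip x y)"
    by metis
  have "bounded_clinear T"
  proof (rule bounded_clinearI[where K = "4 * K"])
    show "T (x + y) = T x + T y" for x y
      by (rule eq_if_ip_eq) (simp add: T ip_add_left bounded_clinear_simps[OF L])
    show "T (c *\<^sub>C x) = c *\<^sub>C T x" for c x
      by (rule eq_if_ip_eq) (simp add: T ip_scaleC_left bounded_clinear_simps[OF L])
    show "norm (T x) \<le> norm x * (4 * K)" for x
      using bound[OF T, of x] by (simp add: ac_simps)
  qed
  with T that show thesis
    by blast
qed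

end

text \<open>The closed span of the inner products is everything, so linear continuous identities in
  \<open>a\<close> need checking only at \<open>a = ip x y\<close>.\<close>

lemma full_ip_induct:
  assumes full: "full_ip ip" and closed: "closed {a. P a}"
    and ip: "\<And>x y. P (ip x y)" and zero: "P 0"
    and add: "\<And>a b. P a \<Longrightarrow> P b \<Longrightarrow> P (a + b)"
    and scaleC: "\<And>c a. P a \<Longrightarrow> P (c *\<^sub>C a)"
  shows "P a"
proof -
  have "complex_vector.span {ip x y |x y. True} \<subseteq> {a. P a}"
    by (rule complex_vector.span_minimal)
      (use ip zero add scaleC in \<open>auto simp: complex_vector.subspace_def\<close>)
  from closure_minimal[OF this closed] full show ?thesis
    by (auto simp: full_ip_def)
qed

text \<open>For \<open>a\<close> in the span of the inner products, \<open>\<parallel>p a\<parallel>\<close> grows at most like \<open>K\<^sup>N\<close> along the powers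
  \<open>p = h\<^sup>N\<close> with \<open>N = 2\<^sup>k\<close>, while \<open>\<parallel>p a\<parallel>\<^sup>2 \<le> \<parallel>a\<parallel> \<parallel>p\<^sup>2 a\<parallel>\<close> makes it grow at least like
  \<open>(\<parallel>h a\<parallel> / \<parallel>a\<parallel>)\<^sup>N\<close>; hence \<open>\<parallel>h a\<parallel> \<le> K \<parallel>a\<parallel>\<close>.\<close>

lemma (in left_hilbert_module) norm_le_if_norm_act_le_selfadjoint:
  assumes full: "full_ip ip" and h: "star h = h" and K: "\<And>x. norm (act h x) \<le> K * norm x"
    and "K \<ge> 0"
  shows "norm h \<le> K"
proof -
  define p where "p = rec_nat h (\<lambda>_ z. z * z)"
  have p: "p 0 = h" "p (Suc k) = p k * p k" for k
    by (simp_all add: p_def)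
  have star_p: "star (p k) = p k" for k
    by (induction k) (simp_all add: p h star_mult)
  have act_p: "norm (act (p k) x) \<le> K ^ 2 ^ k * norm x" for k x
  proof (induction k arbitrary: x)
    case (Suc k)
    have "norm (act (p (Suc k)) x) \<le> K ^ 2 ^ k * norm (act (p k) x)"
      using Suc.IH by (simp add: p act_mult)
    also have "\<dots> \<le> K ^ 2 ^ k * (K ^ 2 ^ k * norm x)"
      using Suc.IH \<open>K \<ge> 0\<close> by (intro mult_left_mono) auto
    finally show ?case
      by (simp add: mult_2 power_add mult.assoc)
  qed (simp add: p K)
  \<comment> \<open>Since \<open>p k * ip x y = ip (act (p k) x) y\<close>, growth in the algebra is
    controlled by growth on the module.\<close>
  have growth: "\<exists>C. \<forall>k. norm (p k * a) \<le> C * K ^ 2 ^ k"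
    if "a \<in> complex_vector.span {ip x y |x y. True}" for a
    using that
  proof (induction rule: complex_vector.span_induct_alt)
    case base
    show ?case
      by (intro exI[of _ 0]) simp
  next
    case (step c a b)
    then obtain C x y where C: "\<And>k. norm (p k * b) \<le> C * K ^ 2 ^ k" and a: "a = ip x y"
      by blast
    have "norm (p k * (c *\<^sub>C a + b)) \<le> (cmod c * (4 * norm x * norm y) + C) * K ^ 2 ^ k" for k
    proof -
      have "norm (p k * a) \<le> 4 * norm (act (p k) x) * norm y"
        using norm_ip_le by (simp add: a flip: ip_act_left)
      also have "\<dots> \<le> 4 * (K ^ 2 ^ k * norm x) * norm y"
        by (intro mult_right_mono mult_left_mono act_p) auto
      finally have "cmod c * norm (p k * a) \<le> cmod c * (4 * (K ^ 2 ^ k * norm x) * norm y)"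
        by (intro mult_left_mono) auto
      moreover have "norm (p k * (c *\<^sub>C a + b)) \<le> cmod c * norm (p k * a) + norm (p k * b)"
        using norm_triangle_ineq[of "c *\<^sub>C (p k * a)" "p k * b"]
        by (simp add: distrib_left mult_scaleC_right norm_scaleC)
      ultimately show ?thesis
        using C[of k] by (simp add: algebra_simps)
    qed
    then show ?case
      by blast
  qed
  have convex: "norm a * norm (h * a) ^ 2 ^ k \<le> norm a ^ 2 ^ k * norm (p k * a)" for a k
  proof (cases "a = 0")
    case False
    show ?thesis
    proof (induction k)
      case (Suc k)
      let ?A = "norm a" and ?F = "norm (h * a)"
      have "(norm (p k * a))\<^sup>2 = norm (star a * (p (Suc k) * a))"
        by (simp add: cstar_identity[symmetric] star_mult star_p p mult.assoc)
      also have "\<dots> \<le> ?A * norm (p (Suc k) * a)"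
        by (metis norm_mult_ineq norm_star)
      finally have "(?A ^ 2 ^ k)\<^sup>2 * (norm (p k * a))\<^sup>2
          \<le> (?A ^ 2 ^ k)\<^sup>2 * (?A * norm (p (Suc k) * a))"
        by (intro mult_left_mono) auto
      moreover have "(?A * ?F ^ 2 ^ k)\<^sup>2 \<le> (?A ^ 2 ^ k * norm (p k * a))\<^sup>2"
        using Suc.IH by (intro power_mono) auto
      \<comment> \<open>The squared induction hypothesis combined with
        \<open>||p a||^2 \<le> ||a|| ||p^2 a||\<close> is the claim with a surplus factor
        \<open>norm a\<close>.\<close>
      ultimately have "?A * (?A * ?F ^ 2 ^ Suc k) \<le> ?A * (?A ^ 2 ^ Suc k * norm (p (Suc k) * a))"
        by (simp add: power_mult_distrib power2_eq_square mult_2 power_add ac_simps)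
      then show ?case
        using False by simp
    qed (simp add: p)
  qed simp
  have span_le: "norm (h * a) \<le> K * norm a"
    if a: "a \<in> complex_vector.span {ip x y |x y. True}" for a
  proof (rule ccontr)
    assume "\<not> ?thesis"
    then have F: "K * norm a < norm (h * a)"
      by simp
    then have "norm (h * a) > 0"
      using \<open>K \<ge> 0\<close> by (meson le_less_trans mult_nonneg_nonneg norm_ge_zero)
    then have A: "norm a > 0"
      by auto
    obtain C where C: "\<And>k. norm (p k * a) \<le> C * K ^ 2 ^ k"
      using growth[OF a] by blast
    have le: "norm a * norm (h * a) ^ 2 ^ k \<le> C * (K * norm a) ^ 2 ^ k" for k
      using convex[of a k] mult_left_mono[OF C[of k], of "norm a ^ 2 ^ k"]
      by (simp add: power_mult_distrib ac_simps)
    \<comment> \<open>If \<open>K = 0\<close>, the estimate at \<open>k = 0\<close> would force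
      \<open>h * a = 0\<close>.\<close>
    have "K \<noteq> 0"
      using le[of 0] A F by auto
    then have KA: "K * norm a > 0"
      using A \<open>K \<ge> 0\<close> by simp
    \<comment> \<open>The estimates bound all \<open>r ^ 2 ^ k\<close> by \<open>C / norm a\<close>,
      impossible for a ratio above 1.\<close>
    define r where "r = norm (h * a) / (K * norm a)"
    have r: "r > 1"
      using F KA by (simp add: r_def)
    obtain k where k: "C / norm a < r ^ k"
      using real_arch_pow[OF r] by blast
    also have "r ^ k \<le> r ^ 2 ^ k"
      using r by (intro power_increasing) (auto simp: less_imp_le)
    also have "\<dots> \<le> C / norm a"
      using le[of k] A zero_less_power[OF KA, of "2 ^ k"]
      by (simp add: r_def power_divide pos_divide_le_eq pos_le_divide_eq mult.commute)
    finally show False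
      by simp
  qed
  have "norm (h * a) \<le> K * norm a" for a
  proof -
    have "closed {a. norm (h * a) \<le> K * norm a}"
      by (intro closed_Collect_le continuous_intros)
    moreover have "complex_vector.span {ip x y |x y. True} \<subseteq> {a. norm (h * a) \<le> K * norm a}"
      using span_le by blast
    ultimately show ?thesis
      using full closure_minimal unfolding full_ip_def by blast
  qed
  \<comment> \<open>At \<open>a = h\<close> the left side is \<open>||h||^2\<close>.\<close>
  from this[of h] cstar_identity[of h] show ?thesis
    by (cases "h = 0") (use \<open>K \<ge> 0\<close> in \<open>simp_all add: h power2_eq_square\<close>)
qed

section \<open>Isometry and faithfulness of the action on a full module\<close>

context left_hilbert_module
begin

text \<open>The selfadjoint case for \<open>star c * c\<close> with bound \<open>norm c * K\<close>;
  the C*-identity then cancels one \<open>norm c\<close>.\<close>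

lemma norm_le_if_norm_act_le:
  assumes "full_ip ip" "\<And>x. norm (act c x) \<le> K * norm x" "K \<ge> 0"
  shows "norm c \<le> K"
proof -
  have "norm (star c * c) \<le> norm c * K"
  proof (rule norm_le_if_norm_act_le_selfadjoint[OF assms(1)])
    show "norm (act (star c * c) x) \<le> norm c * K * norm x" for x
    proof -
      have "norm (act (star c * c) x) \<le> norm c * norm (act c x)"
        using norm_act_le[of "star c" "act c x"] by (simp add: act_mult norm_star)
      also have "\<dots> \<le> norm c * (K * norm x)"
        using assms(2) by (intro mult_left_mono) auto
      finally show ?thesis
        by (simp add: mult.assoc)
    qed
  qed (use assms(3) in \<open>simp_all add: star_mult star_star\<close>)
  then show ?thesis
    by (cases "c = 0") (use assms(3) in \<open>simp_all add: cstar_identity power2_eq_square\<close>)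
qed

lemma eq_if_act_eq:
  assumes "full_ip ip" "\<And>x. act c x = act d x"
  shows "c = d"
  using norm_le_if_norm_act_le[OF assms(1), of "c - d" 0] assms(2) by (simp add: act_diff_left)

lemmas continuous_on_act = bounded_bilinear.continuous_on[OF bounded_bilinear_act]
lemmas continuous_on_ip = bounded_bilinear.continuous_on[OF bounded_bilinear_ip]

end


section \<open>Multipliers\<close>

lemma bounded_clinear_mult_left: "bounded_clinear (mult_left m)"
  by transfer (auto simp: double_centralizer_def)

lemma mult_left_mult: "mult_left m (a * b) = mult_left m a * b"
  by transfer (auto simp: double_centralizer_def)

lemma mult_right_times: "mult_right m a * b = a * mult_left m b"
  by transfer (auto simp: double_centralizer_def)

lemma mult_left_simps:
  "mult_left (m + m') a = mult_left m a + mult_left m' a"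
  "mult_left (c *\<^sub>C m) a = c *\<^sub>C mult_left m a"
  "mult_left (m * m') a = mult_left m (mult_left m' a)"
  "mult_left 1 a = a"
  "mult_left (star m) a = star (mult_right m (star a))"
  by (transfer, auto)+

text \<open>The left half determines the right one through \<open>R a * b = a * L b\<close>.\<close>

lemma multiplier_eqI:
  assumes "\<And>a. mult_left m a = mult_left m' a"
  shows "m = m'"
proof -
  have "mult_right m a = mult_right m' a" for a
    by (rule eq_if_mult_right_eq) (simp add: mult_right_times assms)
  with assms show ?thesis
    by transfer (auto simp: fun_eq_iff)
qed

text \<open>The canonical inclusion of the algebra into its multiplier algebra.\<close>

lift_definition embed_multiplier :: "'a::cstar_algebra \<Rightarrow> 'a multiplier"
  is "\<lambda>a. (\<lambda>b. a * b, \<lambda>b. b * a)"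
proof -
  fix a :: 'a
  have "bounded_clinear (\<lambda>b. a * b)" "bounded_clinear (\<lambda>b. b * a)"
    by (auto simp: bounded_clinear_def bounded_linear_mult_left bounded_linear_mult_right
        mult_scaleC_left mult_scaleC_right)
  then show "double_centralizer (\<lambda>b. a * b, \<lambda>b. b * a)"
    by (simp add: double_centralizer_def mult.assoc)
qed

lemma mult_left_embed: "mult_left (embed_multiplier a) b = a * b"
  by transfer simp

text \<open>Commuting with embedded algebra elements suffices: any other multiplier
  \<open>m'\<close> can be absorbed into an algebra element before \<open>m\<close> passes
  it.\<close>

lemma center_multiplier_iff:
  "m \<in> center \<longleftrightarrow> (\<forall>a b. mult_left m (a * b) = a * mult_left m b)"
proof
  assume "m \<in> center"
  then have "m * embed_multiplier a = embed_multiplier a * m" for a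
    by (simp add: center_def)
  then have "mult_left (m * embed_multiplier a) b = mult_left (embed_multiplier a * m) b" for a b
    by simp
  then show "\<forall>a b. mult_left m (a * b) = a * mult_left m b"
    by (simp add: mult_left_simps mult_left_embed)
next
  assume m: "\<forall>a b. mult_left m (a * b) = a * mult_left m b"
  have "m * m' = m' * m" for m'
  proof (rule multiplier_eqI)
    fix a
    show "mult_left (m * m') a = mult_left (m' * m) a"
    proof (rule eq_if_mult_left_eq)
      fix b
      \<comment> \<open>In multiplier notation:
        \<open>b m m' a = m ((b m') a) = (b m') (m a) = b m' m a\<close>.\<close>
      have "b * mult_left m (mult_left m' a) = mult_left m (mult_right m' b * a)"
        by (simp add: m mult_right_times)
      also have "\<dots> = mult_right m' b * mult_left m a"
        using m by blast
      also have "\<dots> = b * mult_left m' (mult_left m a)"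
        by (rule mult_right_times)
      finally show "b * mult_left (m * m') a = b * mult_left (m' * m) a"
        by (simp add: mult_left_simps)
    qed
  qed
  then show "m \<in> center"
    by (simp add: center_def)
qed

lemma mult_right_center:
  assumes "m \<in> center"
  shows "mult_right m a = mult_left m a"
proof (rule eq_if_mult_right_eq)
  show "mult_right m a * b = mult_left m a * b" for b
    using assms by (simp add: mult_right_times center_multiplier_iff flip: mult_left_mult)
qed

lemma center_closed:
  fixes u v :: "'a::star_algebra"
  assumes "u \<in> center"
  shows "star u \<in> center" "c *\<^sub>C u \<in> center"
    "v \<in> center \<Longrightarrow> u + v \<in> center" "v \<in> center \<Longrightarrow> u * v \<in> center"
proof -
  have "star u * a = a * star u" for a
  proof -
    have "star (u * star a) = star (star a * u)"
      using assms by (simp add: center_def)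
    then show ?thesis
      by (simp add: star_mult star_star)
  qed
  then show "star u \<in> center"
    by (simp add: center_def)
  show "c *\<^sub>C u \<in> center"
    using assms by (simp add: center_def mult_scaleC_left mult_scaleC_right)
  show "u + v \<in> center" if "v \<in> center"
    using assms that by (simp add: center_def distrib_left distrib_right)
  show "u * v \<in> center" if "v \<in> center"
  proof -
    have "u * v * a = a * (u * v)" for a
    proof -
      have ua: "u * a = a * u" and va: "v * a = a * v"
        using assms that by (auto simp: center_def)
      have "u * v * a = u * a * v"
        by (simp only: mult.assoc va)
      also have "\<dots> = a * (u * v)"
        by (simp only: ua mult.assoc)
      finally show ?thesis .
    qed
    then show ?thesis
      by (simp add: center_def)
  qed
qed

section \<open>The action of the multiplier algebra on the module\<close>

context left_hilbert_module
begin

text \<open>Existence comes from \<open>left_centralizer_action_exists\<close> applied to the left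
  half of \<open>m\<close>, uniqueness from density of the products. These facts replace the
  definite description from here on.\<close>

lemma
  shows bounded_clinear_left_mult_action: "bounded_clinear (left_mult_action act m)"
    and ip_left_mult_action: "ip (left_mult_action act m x) y = mult_left m (ip x y)"
    and left_mult_action_unique: "bounded_clinear T \<Longrightarrow>
      (\<And>a x. T (act a x) = act (mult_left m a) x) \<Longrightarrow> left_mult_action act m = T"
proof -
  obtain S where S: "bounded_clinear S" "\<And>x y. ip (S x) y = mult_left m (ip x y)"
    using left_centralizer_action_exists[OF bounded_clinear_mult_left mult_left_mult] by metis
  have S_act: "S (act a x) = act (mult_left m a) x" for a x
    by (rule eq_if_ip_eq) (simp add: S ip_act_left mult_left_mult)
  have unique: "left_mult_action act m = T"
    if "bounded_clinear T" "\<And>a x. T (act a x) = act (mult_left m a) x" for T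
    unfolding left_mult_action_def
  proof (rule the_equality)
    show "T' = T" if "bounded_clinear T' \<and> (\<forall>a x. T' (act a x) = act (mult_left m a) x)" for T'
      using that \<open>bounded_clinear T\<close> \<open>\<And>a x. T (act a x) = act (mult_left m a) x\<close>
      by (intro eq_if_eq_on_act) auto
  qed (use that in simp)
  have "left_mult_action act m = S"
    by (rule unique[OF S(1) S_act])
  with S show "bounded_clinear (left_mult_action act m)"
    "ip (left_mult_action act m x) y = mult_left m (ip x y)"
    by simp_all
  show "left_mult_action act m = T" if "bounded_clinear T"
      "\<And>a x. T (act a x) = act (mult_left m a) x"
    using that by (rule unique)
qed

lemma left_mult_action_simps:
  "left_mult_action act (m + m') x = left_mult_action act m x + left_mult_action act m' x"
  "left_mult_action act (c *\<^sub>C m) x = c *\<^sub>C left_mult_action act m x"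
  "left_mult_action act (m * m') x = left_mult_action act m (left_mult_action act m' x)"
  "left_mult_action act 1 x = x"
  by (rule eq_if_ip_eq;
      simp add: ip_left_mult_action mult_left_simps ip_add_left ip_scaleC_left)+

text \<open>The operator determines \<open>m\<close> on inner products, by
  \<open>ip_left_mult_action\<close>, and fullness extends this to the algebra.\<close>

lemma left_mult_action_inject:
  assumes "full_ip ip" "left_mult_action act m = left_mult_action act m'"
  shows "m = m'"
proof (rule multiplier_eqI)
  fix a
  show "mult_left m a = mult_left m' a"
  proof (rule full_ip_induct[OF assms(1), where P = "\<lambda>a. mult_left m a = mult_left m' a"])
    have "continuous_on UNIV (mult_left m)" for m :: "'a multiplier"
      using bounded_clinear_mult_left
      by (auto simp: bounded_clinear_def intro: linear_continuous_on)
    then show "closed {a. mult_left m a = mult_left m' a}"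
      by (intro closed_Collect_eq)
    show "mult_left m (ip x y) = mult_left m' (ip x y)" for x y
      using assms(2) by (simp flip: ip_left_mult_action)
  qed (simp_all add: bounded_clinear_simps[OF bounded_clinear_mult_left])
qed

text \<open>The left half of \<open>star m\<close> comes from the right half of \<open>m\<close>,
  which for central \<open>m\<close> equals its left half.\<close>

lemma ip_left_mult_action_center:
  assumes "m \<in> center"
  shows "ip (left_mult_action act m x) y = ip x (left_mult_action act (star m) y)"
proof -
  have "ip x (left_mult_action act (star m) y) = star (mult_left (star m) (ip y x))"
    by (metis ip_star ip_left_mult_action)
  also have "\<dots> = mult_left m (ip x y)"
    by (simp add: mult_left_simps star_star ip_star mult_right_center[OF assms])
  finally show ?thesis
    by (simp add: ip_left_mult_action)
qed

end

section \<open>The opposite algebra\<close>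

text \<open>A type of its own, since the class instance fixes the product of a type. Reversing the
  product makes right modules left modules.\<close>

typedef 'a opp = "UNIV :: 'a set"
  morphisms of_opp to_opp
  by auto

setup_lifting type_definition_opp

instantiation opp :: (cstar_algebra) "{star_algebra, complex_normed_vector, real_normed_algebra}"
begin

lift_definition zero_opp :: "'a opp" is 0 .
lift_definition plus_opp :: "'a opp \<Rightarrow> 'a opp \<Rightarrow> 'a opp" is "(+)" .
lift_definition minus_opp :: "'a opp \<Rightarrow> 'a opp \<Rightarrow> 'a opp" is "(-)" .
lift_definition uminus_opp :: "'a opp \<Rightarrow> 'a opp" is uminus .
lift_definition times_opp :: "'a opp \<Rightarrow> 'a opp \<Rightarrow> 'a opp" is "\<lambda>x y. y * x" .
lift_definition scaleR_opp :: "real \<Rightarrow> 'a opp \<Rightarrow> 'a opp" is scaleR .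
lift_definition scaleC_opp :: "complex \<Rightarrow> 'a opp \<Rightarrow> 'a opp" is scaleC .
lift_definition star_opp :: "'a opp \<Rightarrow> 'a opp" is star .
lift_definition norm_opp :: "'a opp \<Rightarrow> real" is norm .
lift_definition dist_opp :: "'a opp \<Rightarrow> 'a opp \<Rightarrow> real" is dist .
lift_definition sgn_opp :: "'a opp \<Rightarrow> 'a opp" is sgn .

definition uniformity_opp :: "('a opp \<times> 'a opp) filter"
  where "uniformity_opp = (INF e\<in>{0 <..}. principal {(x, y). dist x y < e})"

definition open_opp :: "'a opp set \<Rightarrow> bool"
  where "open_opp U \<longleftrightarrow> (\<forall>x\<in>U. eventually (\<lambda>(x', y). x' = x \<longrightarrow> y \<in> U) uniformity)"

instance
proof
  fix x y z :: "'a opp" and c d :: complex and r s :: real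
  show "x + y + z = x + (y + z)"
    by transfer (rule add.assoc)
  show "x + y = y + x"
    by transfer (rule add.commute)
  show "0 + x = x" "- x + x = 0" "x - y = x + - y"
    by (transfer, simp)+
  show "x * y * z = x * (y * z)"
    by transfer (simp add: mult.assoc)
  show "(x + y) * z = x * z + y * z" "x * (y + z) = x * y + x * z"
    by (transfer, simp add: distrib_left distrib_right)+
  show "r *\<^sub>R (x + y) = r *\<^sub>R x + r *\<^sub>R y" "(r + s) *\<^sub>R x = r *\<^sub>R x + s *\<^sub>R x"
    "r *\<^sub>R s *\<^sub>R x = (r * s) *\<^sub>R x" "1 *\<^sub>R x = x"
    by (transfer, simp add: scaleR_add_left scaleR_add_right)+
  show "c *\<^sub>C (x + y) = c *\<^sub>C x + c *\<^sub>C y" "(c + d) *\<^sub>C x = c *\<^sub>C x + d *\<^sub>C x"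
    "c *\<^sub>C d *\<^sub>C x = (c * d) *\<^sub>C x" "complex_of_real r *\<^sub>C x = r *\<^sub>R x"
    by (transfer, simp add: scaleC_add_left scaleC_add_right scaleC_scaleC scaleC_of_real)+
  show "norm (c *\<^sub>C x) = cmod c * norm x"
    by transfer (rule norm_scaleC)
  show "c *\<^sub>C x * y = c *\<^sub>C (x * y)" "x * c *\<^sub>C y = c *\<^sub>C (x * y)"
    by (transfer, simp add: mult_scaleC_left mult_scaleC_right)+
  show "star (x + y) = star x + star y" "star (c *\<^sub>C x) = cnj c *\<^sub>C star x"
    "star (x * y) = star y * star x" "star (star x) = x"
    by (transfer, simp add: star_add star_scaleC star_mult star_star)+
  show "r *\<^sub>R x * y = r *\<^sub>R (x * y)" "x * r *\<^sub>R y = r *\<^sub>R (x * y)"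
    by (transfer, simp)+
  show "norm (x * y) \<le> norm x * norm y"
    by transfer (metis norm_mult_ineq mult.commute)
  show "norm x = 0 \<longleftrightarrow> x = 0" "norm (x + y) \<le> norm x + norm y"
    "norm (r *\<^sub>R x) = \<bar>r\<bar> * norm x" "dist x y = norm (x - y)" "sgn x = inverse (norm x) *\<^sub>R x"
    by (transfer, simp add: norm_triangle_ineq dist_norm sgn_div_norm divide_inverse)+
  show "(uniformity :: ('a opp \<times> 'a opp) filter)
      = (INF e\<in>{0 <..}. principal {(x, y). dist x y < e})"
    by (rule uniformity_opp_def)
  show "open U \<longleftrightarrow> (\<forall>x\<in>U. eventually (\<lambda>(x', y). x' = x \<longrightarrow> y \<in> U) uniformity)"
    for U :: "'a opp set"
    by (rule open_opp_def)
qed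

end

instance opp :: (cstar_algebra) cstar_algebra
proof
  show "norm (star x * x) = (norm x)\<^sup>2" for x :: "'a opp"
    by transfer (rule norm_mult_star)
  fix X :: "nat \<Rightarrow> 'a opp"
  assume "Cauchy X"
  then have "Cauchy (\<lambda>n. of_opp (X n))"
    by (simp add: Cauchy_def dist_opp.rep_eq)
  then obtain l where "(\<lambda>n. of_opp (X n)) \<longlonglongrightarrow> l"
    using Cauchy_convergent_iff convergent_def by blast
  then have "X \<longlonglongrightarrow> to_opp l"
    by (simp add: lim_sequentially dist_opp.rep_eq to_opp_inverse)
  then show "convergent X"
    by (auto simp: convergent_def)
qed

lemmas of_opp_to_opp [simp] = to_opp_inverse[OF UNIV_I] and to_opp_of_opp [simp] = of_opp_inverse

lemmas of_opp_simps = zero_opp.rep_eq plus_opp.rep_eq times_opp.rep_eq scaleC_opp.rep_eq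
  star_opp.rep_eq norm_opp.rep_eq

lemma to_opp_simps:
  "to_opp (a + b) = to_opp a + to_opp b" "to_opp (a * b) = to_opp b * to_opp a"
  "to_opp (c *\<^sub>C a) = c *\<^sub>C to_opp a" "to_opp (star a) = star (to_opp a)" "to_opp 0 = 0"
  "norm (to_opp a) = norm a"
  by (simp_all add: of_opp_simps flip: of_opp_inject)

section \<open>Maps, inner products and multipliers over the opposite algebra\<close>

lemma bounded_clinear_opp:
  assumes "bounded_clinear f"
  shows "bounded_clinear (\<lambda>a. to_opp (f (of_opp a)))"
proof -
  obtain K where "\<And>x. norm (f x) \<le> norm x * K"
    using bounded_clinear_bounded[OF assms] by blast
  then show ?thesis
    by (intro bounded_clinearI[where K = K])
      (simp_all add: of_opp_simps to_opp_simps bounded_clinear_simps[OF assms])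
qed

lemma bounded_clinear_unopp:
  assumes "bounded_clinear f"
  shows "bounded_clinear (\<lambda>a. of_opp (f (to_opp a)))"
proof -
  obtain K where K: "\<And>x. norm (f x) \<le> norm x * K"
    using bounded_clinear_bounded[OF assms] by blast
  have "norm (of_opp (f (to_opp a))) \<le> norm a * K" for a
    using K[of "to_opp a"] by (simp add: to_opp_simps norm_opp.rep_eq)
  then show ?thesis
    by (intro bounded_clinearI[where K = K])
      (simp_all add: of_opp_simps to_opp_simps bounded_clinear_simps[OF assms])
qed

lemma full_ip_opp:
  assumes "full_ip ip"
  shows "full_ip (\<lambda>x y. to_opp (ip y x))"
proof -
  let ?S = "complex_vector.span {to_opp (ip y x) |x y. True}"
  have cont: "continuous_on UNIV (to_opp :: 'c::cstar_algebra \<Rightarrow> 'c opp)"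
    by (rule linear_continuous_on, rule bounded_linear_intro[where K = 1])
      (simp_all add: to_opp_simps flip: scaleC_of_real)
  have "to_opp a \<in> closure ?S" for a
  proof -
    have "complex_vector.span {ip x y |x y. True} \<subseteq> {a. to_opp a \<in> ?S}"
      by (rule complex_vector.span_minimal)
        (auto simp: complex_vector.subspace_def to_opp_simps complex_vector.span_zero
          complex_vector.span_add complex_vector.span_scale intro: complex_vector.span_base)
    also have "\<dots> \<subseteq> to_opp -` closure ?S"
      using closure_subset by auto
    finally have "closure (complex_vector.span {ip x y |x y. True}) \<subseteq> to_opp -` closure ?S"
      using cont by (intro closure_minimal) (auto intro: closed_vimage)
    then show ?thesis
      using assms by (auto simp: full_ip_def)
  qed
  then have "b \<in> closure ?S" for b
    using to_opp_of_opp[of b] by metis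
  then show ?thesis
    by (auto simp: full_ip_def)
qed

text \<open>The canonical anti-isomorphism onto the multipliers of the opposite algebra; left and
  right multiplication trade places.\<close>

lift_definition opp_multiplier :: "'a::cstar_algebra multiplier \<Rightarrow> 'a opp multiplier"
  is "\<lambda>(L, R). (\<lambda>a. to_opp (R (of_opp a)), \<lambda>a. to_opp (L (of_opp a)))"
  by (auto simp: double_centralizer_def bounded_clinear_opp of_opp_simps
      simp flip: of_opp_inject)

lemma mult_left_opp: "mult_left (opp_multiplier m) a = to_opp (mult_right m (of_opp a))"
  by (simp add: mult_left.rep_eq mult_right.rep_eq opp_multiplier.rep_eq case_prod_beta)

lemma mult_right_opp: "mult_right (opp_multiplier m) a = to_opp (mult_left m (of_opp a))"
  by (simp add: mult_left.rep_eq mult_right.rep_eq opp_multiplier.rep_eq case_prod_beta)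

lemma mult_right_simps:
  "mult_right (m + m') a = mult_right m a + mult_right m' a"
  "mult_right (c *\<^sub>C m) a = c *\<^sub>C mult_right m a"
  "mult_right (m * m') a = mult_right m' (mult_right m a)"
  "mult_right 1 a = a"
  "mult_right (star m) a = star (mult_left m (star a))"
  by (transfer, auto)+

lemma opp_multiplier_simps:
  "opp_multiplier (m + m') = opp_multiplier m + opp_multiplier m'"
  "opp_multiplier (c *\<^sub>C m) = c *\<^sub>C opp_multiplier m"
  "opp_multiplier (m * m') = opp_multiplier m' * opp_multiplier m"
  "opp_multiplier 1 = 1"
  "opp_multiplier (star m) = star (opp_multiplier m)"
  by (rule multiplier_eqI; simp add: mult_left_opp mult_right_opp mult_left_simps mult_right_simps
      to_opp_simps of_opp_simps)+

lemma bij_opp_multiplier: "bij (opp_multiplier :: 'a::cstar_algebra multiplier \<Rightarrow> _)"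
proof (rule bijI)
  show "inj (opp_multiplier :: 'a multiplier \<Rightarrow> _)"
  proof (rule injI)
    fix m m' :: "'a multiplier"
    assume eq: "opp_multiplier m = opp_multiplier m'"
    show "m = m'"
    proof (rule multiplier_eqI)
      show "mult_left m a = mult_left m' a" for a
        using mult_right_opp[of m "to_opp a"] mult_right_opp[of m' "to_opp a"] eq
        by (metis of_opp_to_opp)
    qed
  qed
  show "surj (opp_multiplier :: 'a multiplier \<Rightarrow> _)"
    unfolding surj_def
  proof
    fix n :: "'a opp multiplier"
    \<comment> \<open>The preimage is found by exchanging the halves of \<open>n\<close>
      back.\<close>
    let ?L = "\<lambda>a. of_opp (mult_right n (to_opp a))"
    let ?R = "\<lambda>a. of_opp (mult_left n (to_opp a))"
    have "double_centralizer (mult_left n, mult_right n)"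
      by transfer simp
    then have n: "bounded_clinear (mult_left n)" "bounded_clinear (mult_right n)"
      "\<And>a b. mult_left n (a * b) = mult_left n a * b"
      "\<And>a b. mult_right n (a * b) = a * mult_right n b"
      "\<And>a b. mult_right n a * b = a * mult_left n b"
      by (auto simp: double_centralizer_def)
    have "?R a * b = a * ?L b" for a b
      using arg_cong[OF n(5)[of "to_opp b" "to_opp a"], of of_opp] by (simp add: of_opp_simps)
    then have "double_centralizer (?L, ?R)"
      using n by (auto simp: double_centralizer_def to_opp_simps of_opp_simps bounded_clinear_unopp)
    then have "mult_left (Abs_multiplier (?L, ?R)) = ?L" "mult_right (Abs_multiplier (?L, ?R)) = ?R"
      by (simp_all add: mult_left.rep_eq mult_right.rep_eq Abs_multiplier_inverse)
    then have "n = opp_multiplier (Abs_multiplier (?L, ?R))"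
      by (intro multiplier_eqI) (simp add: mult_left_opp)
    then show "\<exists>m. n = opp_multiplier m"
      by blast
  qed
qed

lemma opp_multiplier_inject: "opp_multiplier m = opp_multiplier m' \<longleftrightarrow> m = m'"
  using bij_is_inj[OF bij_opp_multiplier] by (auto dest: injD)

lemma opp_multiplier_cases:
  obtains m where "n = opp_multiplier m"
  using surjD[OF bij_is_surj[OF bij_opp_multiplier]] by blast

lemma opp_multiplier_center_iff: "opp_multiplier m \<in> center \<longleftrightarrow> m \<in> center"
proof
  assume "opp_multiplier m \<in> center"
  then have "opp_multiplier (m' * m) = opp_multiplier (m * m')" for m'
    by (simp add: opp_multiplier_simps center_def)
  then show "m \<in> center"
    by (simp add: opp_multiplier_inject center_def)
next
  assume m: "m \<in> center"
  have "opp_multiplier m * n = n * opp_multiplier m" for n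
  proof -
    obtain m' where n: "n = opp_multiplier m'"
      by (rule opp_multiplier_cases)
    have "m' * m = m * m'"
      using m by (simp add: center_def)
    then show ?thesis
      by (simp add: n flip: opp_multiplier_simps(3))
  qed
  then show "opp_multiplier m \<in> center"
    by (simp add: center_def)
qed

lemma unitary_opp_multiplier_iff: "unitary (opp_multiplier m) \<longleftrightarrow> unitary m"
proof -
  have "unitary (opp_multiplier m) \<longleftrightarrow>
      opp_multiplier (m * star m) = opp_multiplier 1 \<and> opp_multiplier (star m * m) = opp_multiplier 1"
    by (simp add: unitary_def opp_multiplier_simps)
  then show ?thesis
    by (auto simp: opp_multiplier_inject unitary_def)
qed

text \<open>Both definite descriptions impose the same condition on \<open>T\<close>; right actions
  thereby inherit the theory of left ones.\<close>

lemma right_mult_action_opp: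
  "right_mult_action act m = left_mult_action (\<lambda>b x. act x (of_opp b)) (opp_multiplier m)"
proof -
  have "(\<forall>b x. T (act x (of_opp b)) = act x (mult_right m (of_opp b)))
      \<longleftrightarrow> (\<forall>x b. T (act x b) = act x (mult_right m b))" for T
    by (metis of_opp_to_opp)
  then show ?thesis
    by (simp add: right_mult_action_def left_mult_action_def mult_left_opp)
qed

section \<open>Modules over the opposite algebras\<close>

lemma (in left_hilbert_module) right_hilbert_module_opp:
  "right_hilbert_module (\<lambda>x a. act (of_opp a) x) (\<lambda>x y. to_opp (ip y x))"
proof
  show "cstar_positive (to_opp (ip x x))" for x
  proof -
    obtain c where "ip x x = star c * c"
      using ip_positive[of x] by (auto simp: cstar_positive_def)
    \<comment> \<open>The reversed product turns the positivity witness \<open>c\<close> into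
      \<open>star (to_opp c)\<close>.\<close>
    then have "to_opp (ip x x) = star (star (to_opp c)) * star (to_opp c)"
      by (simp add: to_opp_simps star_star)
    then show ?thesis
      unfolding cstar_positive_def by blast
  qed
qed (simp_all add: of_opp_simps to_opp_simps act_add_left act_add_right act_scaleC_left
    act_scaleC_right act_mult ip_add_left ip_scaleC_left ip_act_left norm_eq_ip ip_star
    flip: to_opp_simps(4))

lemma (in right_hilbert_module) left_hilbert_module_opp:
  "left_hilbert_module (\<lambda>b x. act x (of_opp b)) (\<lambda>x y. to_opp (ip y x))"
proof
  show "cstar_positive (to_opp (ip x x))" for x
  proof -
    obtain c where "ip x x = star c * c"
      using ip_positive[of x] by (auto simp: cstar_positive_def)
    then have "to_opp (ip x x) = star (star (to_opp c)) * star (to_opp c)"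
      by (simp add: to_opp_simps star_star)
    then show ?thesis
      unfolding cstar_positive_def by blast
  qed
qed (simp_all add: of_opp_simps to_opp_simps act_add_left act_add_right act_scaleC_left
    act_scaleC_right act_mult ip_add_right ip_scaleC_right ip_act_right norm_eq_ip ip_star
    flip: to_opp_simps(4))

text \<open>The source of the symmetry between \<open>A\<close> and \<open>B\<close>: the
  compatibility of the inner products is the original one read backwards.\<close>

lemma (in imprimitivity_bimodule) imprimitivity_bimodule_opp:
  "imprimitivity_bimodule (\<lambda>b x. actB x (of_opp b)) (\<lambda>x y. to_opp (ipB y x))
    (\<lambda>x a. actA (of_opp a) x) (\<lambda>x y. to_opp (ipA y x))"
  using B.left_hilbert_module_opp A.right_hilbert_module_opp
  by (auto simp: imprimitivity_bimodule_def imprimitivity_bimodule_axioms_def ip_compat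
      intro: full_ip_opp full_A full_B)


section \<open>Bimodule maps\<close>

context right_hilbert_module
begin

lemma bounded_bilinear_act: "bounded_bilinear act"
proof -
  interpret opp: left_hilbert_module "\<lambda>b x. act x (of_opp b)" "\<lambda>x y. to_opp (ip y x)"
    by (rule left_hilbert_module_opp)
  show ?thesis
  proof
    have "norm (act x b) \<le> norm x * norm b * 1" for x b
      using opp.norm_act_le[where a = "to_opp b" and x = x] by (simp add: to_opp_simps mult.commute)
    then show "\<exists>K. \<forall>x b. norm (act x b) \<le> norm x * norm b * K"
      by blast
  qed (simp_all add: act_add_left act_add_right act_scaleC_left act_scaleC_right
      flip: scaleC_of_real)
qed

lemmas continuous_on_act = bounded_bilinear.continuous_on[OF bounded_bilinear_act]

lemma eq_if_ip_eq:
  assumes "\<And>y. ip x y = ip x' y"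
  shows "x = x'"
proof -
  interpret opp: left_hilbert_module "\<lambda>b x. act x (of_opp b)" "\<lambda>x y. to_opp (ip y x)"
    by (rule left_hilbert_module_opp)
  show ?thesis
    using assms by (intro opp.eq_if_ip_eq_right) simp
qed

lemma eq_if_act_eq:
  assumes "full_ip ip" "\<And>x. act x b = act x c"
  shows "b = c"
proof -
  interpret opp: left_hilbert_module "\<lambda>b x. act x (of_opp b)" "\<lambda>x y. to_opp (ip y x)"
    by (rule left_hilbert_module_opp)
  have "to_opp b = to_opp c"
    by (rule opp.eq_if_act_eq) (use assms full_ip_opp in auto)
  then show ?thesis
    by (metis of_opp_to_opp)
qed

end

definition bimodule_map ::
    "('a \<Rightarrow> 'x \<Rightarrow> 'x) \<Rightarrow> ('x \<Rightarrow> 'b \<Rightarrow> 'x) \<Rightarrow> ('x::complex_normed_vector \<Rightarrow> 'x) \<Rightarrow> bool"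
  where "bimodule_map actA actB T \<longleftrightarrow> bounded_clinear T \<and>
    (\<forall>a x. T (actA a x) = actA a (T x)) \<and> (\<forall>x b. T (actB x b) = actB (T x) b)"

lemma bimodule_map_opp:
  "bimodule_map (\<lambda>b x. actB x (of_opp b)) (\<lambda>x a. actA (of_opp a) x) T \<longleftrightarrow> bimodule_map actA actB T"
  unfolding bimodule_map_def by (metis of_opp_to_opp)

lemma preserves_ip_opp: "preserves_ip (\<lambda>x y. to_opp (ip y x)) T \<longleftrightarrow> preserves_ip ip T"
  unfolding preserves_ip_def by (metis of_opp_to_opp)

lemma continuous_on_star: "continuous_on UNIV (star :: 'a::cstar_algebra \<Rightarrow> 'a)"
  by (rule linear_continuous_on, rule bounded_linear_intro[where K = 1])
    (simp_all add: star_add star_scaleC norm_star flip: scaleC_of_real)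

section \<open>Bimodule maps and central multipliers\<close>

context imprimitivity_bimodule
begin

text \<open>For \<open>b = ipB z w\<close>, compatibility turns both sides into
  \<open>ipA x z * ipA w y\<close>; fullness does the rest.\<close>

lemma ipA_actB: "ipA (actB x b) y = ipA x (actB y (star b))"
proof (rule full_ip_induct[OF full_B, where P = "\<lambda>b. ipA (actB x b) y = ipA x (actB y (star b))"])
  show "closed {b. ipA (actB x b) y = ipA x (actB y (star b))}"
    by (intro closed_Collect_eq A.continuous_on_ip B.continuous_on_act continuous_on_star
        continuous_intros)
  show "ipA (actB x (ipB z w)) y = ipA x (actB y (star (ipB z w)))" for z w
    by (simp add: A.ip_act_left A.ip_act_right A.ip_star B.ip_star flip: ip_compat)
qed (simp_all add: B.act_add_right B.act_scaleC_right A.ip_add_left A.ip_add_right star_add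
    star_scaleC A.ip_scaleC_left A.ip_scaleC_right star_eq_zero_simps
    bounded_bilinear.zero_left[OF A.bounded_bilinear_ip]
    bounded_bilinear.zero_right[OF A.bounded_bilinear_ip]
    bounded_bilinear.zero_right[OF B.bounded_bilinear_act])

text \<open>Linearity over \<open>A\<close> is centrality of \<open>u\<close>; linearity over
  \<open>B\<close> is adjointability of the right action, \<open>ipA_actB\<close>.\<close>

lemma bimodule_map_left_mult_action:
  assumes "u \<in> center"
  shows "bimodule_map actA actB (left_mult_action actA u)"
  unfolding bimodule_map_def
proof (intro conjI allI)
  show "bounded_clinear (left_mult_action actA u)"
    by (rule A.bounded_clinear_left_mult_action)
  show "left_mult_action actA u (actA a x) = actA a (left_mult_action actA u x)" for a x
    by (rule A.eq_if_ip_eq)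
      (use assms in \<open>simp add: A.ip_left_mult_action A.ip_act_left center_multiplier_iff\<close>)
  show "left_mult_action actA u (actB x b) = actB (left_mult_action actA u x) b" for x b
    by (rule A.eq_if_ip_eq) (simp add: A.ip_left_mult_action ipA_actB)
qed

lemma bimodule_map_obtains_center:
  assumes "bimodule_map actA actB T"
  obtains u where "u \<in> center" "left_mult_action actA u = T"
proof -
  from assms have T: "bounded_clinear T" and TA: "\<And>a x. T (actA a x) = actA a (T x)"
    and TB: "\<And>x b. T (actB x b) = actB (T x) b"
    by (auto simp: bimodule_map_def)
  then have lin: "bounded_linear T"
    by (simp add: bounded_clinear_def)
  obtain K where K: "K > 0" "\<And>x. norm (T x) \<le> norm x * K"
    using bounded_linear.pos_bounded[OF lin] by blast
  \<comment> \<open>The norm of \<open>c\<close> is read off its action. This yields both closedness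
    below and boundedness of \<open>L\<close>.\<close>
  have bound: "norm c \<le> K * norm a" if c: "\<And>x. actA c x = T (actA a x)" for a c
  proof (rule A.norm_le_if_norm_act_le[OF full_A])
    fix x
    have "norm (actA c x) \<le> norm (actA a x) * K"
      using K(2) by (simp add: c)
    also have "\<dots> \<le> norm a * norm x * K"
      using K(1) A.norm_act_le by (intro mult_right_mono) auto
    finally show "norm (actA c x) \<le> K * norm a * norm x"
      by (simp add: ac_simps)
  qed (use K(1) in simp)
  have "\<exists>c. \<forall>x. actA c x = T (actA a x)" for a
  proof (rule full_ip_induct[OF full_A, where P = "\<lambda>a. \<exists>c. \<forall>x. actA c x = T (actA a x)"])
    show "closed {a. \<exists>c. \<forall>x. actA c x = T (actA a x)}"
      unfolding closed_sequential_limits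
    proof (intro allI impI, elim conjE)
      fix f l
      assume "\<forall>n. f n \<in> {a. \<exists>c. \<forall>x. actA c x = T (actA a x)}" and l: "f \<longlonglongrightarrow> l"
      then obtain g where g: "\<And>n x. actA (g n) x = T (actA (f n) x)"
        by simp metis
      have diff: "norm (g m - g n) \<le> K * norm (f m - f n)" for m n
        by (rule bound) (simp add: A.act_diff_left g bounded_clinear_simps[OF T])
      obtain c where c: "g \<longlonglongrightarrow> c"
        by (rule LIMSEQ_if_norm_diff_le[OF l diff])
      have "actA c x = T (actA l x)" for x
      proof (rule LIMSEQ_unique)
        show "(\<lambda>n. actA (g n) x) \<longlonglongrightarrow> actA c x"
          by (intro bounded_bilinear.tendsto[OF A.bounded_bilinear_act] c tendsto_const)
        show "(\<lambda>n. actA (g n) x) \<longlonglongrightarrow> T (actA l x)"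
          unfolding g
          by (intro bounded_linear.tendsto[OF lin]
              bounded_bilinear.tendsto[OF A.bounded_bilinear_act] l tendsto_const)
      qed
      then show "l \<in> {a. \<exists>c. \<forall>x. actA c x = T (actA a x)}"
        by blast
    qed
    \<comment> \<open>Linearity over \<open>B\<close> enters here:
      \<open>T (y \<langle>z, x\<rangle>) = (T y) \<langle>z, x\<rangle>\<close>, and compatibility
      returns to \<open>ipA (T y) z\<close> acting on \<open>x\<close>.\<close>
    show "\<exists>c. \<forall>x. actA c x = T (actA (ipA y z) x)" for y z
      by (rule exI[of _ "ipA (T y) z"]) (simp add: ip_compat TB)
    show "\<exists>c. \<forall>x. actA c x = T (actA 0 x)"
      by (rule exI[of _ 0])
        (simp add: bounded_bilinear.zero_left[OF A.bounded_bilinear_act] bounded_clinear_simps[OF T])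
    show "\<exists>c. \<forall>x. actA c x = T (actA (a + b) x)"
      if a: "\<exists>c. \<forall>x. actA c x = T (actA a x)" and b: "\<exists>c. \<forall>x. actA c x = T (actA b x)" for a b
    proof -
      from a b obtain c d where "\<And>x. actA c x = T (actA a x)" "\<And>x. actA d x = T (actA b x)"
        by blast
      then show ?thesis
        by (intro exI[of _ "c + d"]) (simp add: A.act_add_left bounded_clinear_simps[OF T])
    qed
    show "\<exists>c. \<forall>x. actA c x = T (actA (r *\<^sub>C a) x)"
      if a: "\<exists>c. \<forall>x. actA c x = T (actA a x)" for r a
    proof -
      from a obtain c where "\<And>x. actA c x = T (actA a x)"
        by blast
      then show ?thesis
        by (intro exI[of _ "r *\<^sub>C c"]) (simp add: A.act_scaleC_left bounded_clinear_simps[OF T])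
    qed
  qed
  then obtain L where L: "\<And>a x. actA (L a) x = T (actA a x)"
    by metis
  have bounded_L: "bounded_clinear L"
  proof (rule bounded_clinearI[where K = K])
    show "L (a + b) = L a + L b" for a b
      by (rule A.eq_if_act_eq[OF full_A])
        (simp add: L A.act_add_left bounded_clinear_simps[OF T])
    show "L (c *\<^sub>C a) = c *\<^sub>C L a" for c a
      by (rule A.eq_if_act_eq[OF full_A])
        (simp add: L A.act_scaleC_left bounded_clinear_simps[OF T])
    show "norm (L a) \<le> norm a * K" for a
      using bound[OF L, of a] by (simp add: mult.commute)
  qed
  \<comment> \<open>On the module both are \<open>T (a b x)\<close>: either absorb \<open>T\<close>
    into \<open>a\<close>, or first move it past \<open>a\<close> by \<open>A\<close>-linearity.
    Hence \<open>L\<close> serves as both halves of a centralizer.\<close>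
  have L_left: "L (a * b) = L a * b" and L_right: "L (a * b) = a * L b" for a b
    by (rule A.eq_if_act_eq[OF full_A]; simp add: L A.act_mult TA)+
  have "L a * b = a * L b" for a b
    by (rule trans[OF L_left[symmetric] L_right])
  then have "double_centralizer (L, L)"
    unfolding double_centralizer_def prod.case by (intro conjI allI bounded_L L_left L_right)
  then have u: "mult_left (Abs_multiplier (L, L)) = L"
    by (simp add: mult_left.rep_eq Abs_multiplier_inverse)
  show thesis
  proof (rule that)
    show "Abs_multiplier (L, L) \<in> center"
      by (simp add: center_multiplier_iff u L_right)
    show "left_mult_action actA (Abs_multiplier (L, L)) = T"
      by (rule A.left_mult_action_unique) (simp_all add: T u L)
  qed
qed

lemma bij_betw_left_mult_action:
  "bij_betw (left_mult_action actA) center {T. bimodule_map actA actB T}"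
proof (rule bij_betw_imageI)
  show "inj_on (left_mult_action actA) center"
    using A.left_mult_action_inject[OF full_A] by (auto intro: inj_onI)
  show "left_mult_action actA ` center = {T. bimodule_map actA actB T}"
    using bimodule_map_left_mult_action bimodule_map_obtains_center by (auto simp: image_iff) metis
qed

section \<open>Adjoints and unitary central multipliers\<close>

lemma ipB_left_mult_action_center:
  assumes "u \<in> center"
  shows "ipB (left_mult_action actA u x) y = ipB x (left_mult_action actA (star u) y)"
proof (rule B.eq_if_act_eq[OF full_B])
  fix z
  let ?T = "left_mult_action actA u" and ?S = "left_mult_action actA (star u)"
  have S: "bimodule_map actA actB ?S"
    using assms by (intro bimodule_map_left_mult_action center_closed)
  \<comment> \<open>Acting on \<open>z\<close> turns the \<open>B\<close>-valued product into an
    \<open>A\<close>-valued one, whose adjoint is known. Then \<open>B\<close>-linearity pulls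
    \<open>?S\<close> out and \<open>A\<close>-linearity moves it onto \<open>y\<close>.\<close>
  have "actB z (ipB (?T x) y) = actA (ipA z (?T x)) y"
    by (simp add: ip_compat)
  also have "\<dots> = actA (ipA (?S z) x) y"
    using A.ip_left_mult_action_center[OF center_closed(1)[OF assms]] by (simp add: star_star)
  also have "\<dots> = ?S (actA (ipA z x) y)"
    using S by (simp add: ip_compat bimodule_map_def)
  also have "\<dots> = actB z (ipB x (?S y))"
    using S by (simp add: bimodule_map_def flip: ip_compat)
  finally show "actB z (ipB (?T x) y) = actB z (ipB x (?S y))" .
qed

lemma unitary_center_actions:
  "{left_mult_action actA u |u. u \<in> center \<and> unitary u}
    = {T. bij T \<and> bimodule_map actA actB T \<and> preserves_ip ipA T \<and> preserves_ip ipB T}"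
proof (intro subset_antisym subsetI)
  fix T
  assume "T \<in> {left_mult_action actA u |u. u \<in> center \<and> unitary u}"
  then obtain u where T: "T = left_mult_action actA u" and u: "u \<in> center" "unitary u"
    by blast
  let ?S = "left_mult_action actA (star u)"
  \<comment> \<open>Unitarity of \<open>u\<close> makes the adjoint of \<open>T\<close> its
    inverse.\<close>
  have inv: "?S (T x) = x" "T (?S x) = x" for x
    using u(2) by (simp_all add: T unitary_def A.left_mult_action_simps(4)
        flip: A.left_mult_action_simps(3))
  then have "bij T"
    by (metis o_bij comp_apply eq_id_iff)
  moreover have "preserves_ip ipA T" "preserves_ip ipB T"
    using inv(1) unfolding preserves_ip_def T
    by (simp_all add: A.ip_left_mult_action_center[OF u(1)] ipB_left_mult_action_center[OF u(1)])
  ultimately show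
    "T \<in> {T. bij T \<and> bimodule_map actA actB T \<and> preserves_ip ipA T \<and> preserves_ip ipB T}"
    using bimodule_map_left_mult_action[OF u(1)] by (simp add: T)
next
  fix T
  assume "T \<in> {T. bij T \<and> bimodule_map actA actB T \<and> preserves_ip ipA T \<and> preserves_ip ipB T}"
  then have T: "bimodule_map actA actB T" "preserves_ip ipA T"
    by auto
  obtain u where u: "u \<in> center" and Tu: "left_mult_action actA u = T"
    using bimodule_map_obtains_center[OF T(1)] .
  \<comment> \<open>Preservation of \<open>ipA\<close> says that the adjoint of \<open>T\<close> is
    a left inverse; faithfulness returns this to multipliers.\<close>
  have "left_mult_action actA (star u * u) = left_mult_action actA 1"
  proof
    fix x
    show "left_mult_action actA (star u * u) x = left_mult_action actA 1 x"
    proof (rule A.eq_if_ip_eq)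
      show "ipA (left_mult_action actA (star u * u) x) y = ipA (left_mult_action actA 1 x) y" for y
        using T(2) A.ip_left_mult_action_center[OF center_closed(1)[OF u]]
        by (simp add: A.left_mult_action_simps star_star Tu preserves_ip_def)
    qed
  qed
  then have "star u * u = 1"
    by (rule A.left_mult_action_inject[OF full_A])
  moreover have "u * star u = star u * u"
    using u by (simp add: center_def)
  ultimately have "unitary u"
    by (simp add: unitary_def)
  then show "T \<in> {left_mult_action actA u |u. u \<in> center \<and> unitary u}"
    using u Tu by blast
qed

text \<open>\<open>T (x \<langle>y, z\<rangle>\<^sub>B) = T (\<langle>x, y\<rangle>\<^sub>A z) = \<langle>T x, T y\<rangle>\<^sub>A T z = T x \<langle>T y, T z\<rangle>\<^sub>B\<close>.\<close>

lemma actB_linear_if_actA_linear: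
  assumes T: "bounded_clinear T" and TA: "\<And>a x. T (actA a x) = actA a (T x)"
    and ip: "preserves_ip ipA T" "preserves_ip ipB T"
  shows "T (actB x b) = actB (T x) b"
proof (rule full_ip_induct[OF full_B, where P = "\<lambda>b. T (actB x b) = actB (T x) b"])
  have "bounded_linear T"
    using T by (simp add: bounded_clinear_def)
  then have "continuous_on UNIV T"
    by (rule linear_continuous_on)
  then have "continuous_on UNIV (\<lambda>b. T (actB x b))"
    by (rule continuous_on_compose2) (intro B.continuous_on_act continuous_intros subset_UNIV)+
  then show "closed {b. T (actB x b) = actB (T x) b}"
    by (rule closed_Collect_eq) (intro B.continuous_on_act continuous_intros)
  show "T (actB x (ipB y z)) = actB (T x) (ipB y z)" for y z
  proof -
    have "T (actB x (ipB y z)) = actA (ipA (T x) (T y)) (T z)"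
      using ip(1) by (simp add: TA preserves_ip_def flip: ip_compat)
    also have "\<dots> = actB (T x) (ipB y z)"
      using ip(2) by (simp add: ip_compat preserves_ip_def)
    finally show ?thesis .
  qed
qed (simp_all add: B.act_add_right B.act_scaleC_right bounded_clinear_simps[OF T]
    bounded_bilinear.zero_right[OF B.bounded_bilinear_act])

lemma actA_linear_if_actB_linear:
  assumes T: "bounded_clinear T" and TB: "\<And>x b. T (actB x b) = actB (T x) b"
    and ip: "preserves_ip ipA T" "preserves_ip ipB T"
  shows "T (actA a x) = actA a (T x)"
proof -
  interpret opp: imprimitivity_bimodule "\<lambda>b x. actB x (of_opp b)" "\<lambda>x y. to_opp (ipB y x)"
    "\<lambda>x a. actA (of_opp a) x" "\<lambda>x y. to_opp (ipA y x)"
    by (rule imprimitivity_bimodule_opp)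
  show ?thesis
    using opp.actB_linear_if_actA_linear[OF T, where x = x and b = "to_opp a"] TB ip
    by (simp add: preserves_ip_opp)
qed

section \<open>Transfer to \<open>Z(M(B))\<close> and identification of the two centers\<close>

lemma bij_betw_right_mult_action:
  "bij_betw (right_mult_action actB) center {T. bimodule_map actA actB T}"
proof -
  interpret opp: imprimitivity_bimodule "\<lambda>b x. actB x (of_opp b)" "\<lambda>x y. to_opp (ipB y x)"
    "\<lambda>x a. actA (of_opp a) x" "\<lambda>x y. to_opp (ipA y x)"
    by (rule imprimitivity_bimodule_opp)
  have "opp_multiplier ` center = (center :: 'b opp multiplier set)"
  proof (intro subset_antisym subsetI)
    fix n :: "'b opp multiplier"
    assume "n \<in> center"
    moreover obtain m where "n = opp_multiplier m"
      by (rule opp_multiplier_cases)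
    ultimately show "n \<in> opp_multiplier ` center"
      by (simp add: opp_multiplier_center_iff)
  qed (auto simp: opp_multiplier_center_iff)
  then have "bij_betw opp_multiplier center (center :: 'b opp multiplier set)"
    by (intro bij_betw_imageI inj_on_subset[OF bij_is_inj[OF bij_opp_multiplier]] subset_UNIV)
  \<comment> \<open>The opposite bimodule has the same bimodule maps.\<close>
  from bij_betw_trans[OF this opp.bij_betw_left_mult_action] show ?thesis
    by (simp add: bimodule_map_opp comp_def flip: right_mult_action_opp)
qed

lemma right_mult_action_simps:
  "right_mult_action actB (v + w) x = right_mult_action actB v x + right_mult_action actB w x"
  "right_mult_action actB (c *\<^sub>C v) x = c *\<^sub>C right_mult_action actB v x"
  "right_mult_action actB (v * w) x = right_mult_action actB w (right_mult_action actB v x)"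
  and ipB_right_mult_action_center: "v \<in> center \<Longrightarrow>
    ipB (right_mult_action actB v x) y = ipB x (right_mult_action actB (star v) y)"
proof -
  interpret opp: imprimitivity_bimodule "\<lambda>b x. actB x (of_opp b)" "\<lambda>x y. to_opp (ipB y x)"
    "\<lambda>x a. actA (of_opp a) x" "\<lambda>x y. to_opp (ipA y x)"
    by (rule imprimitivity_bimodule_opp)
  show "right_mult_action actB (v + w) x = right_mult_action actB v x + right_mult_action actB w x"
    "right_mult_action actB (c *\<^sub>C v) x = c *\<^sub>C right_mult_action actB v x"
    "right_mult_action actB (v * w) x = right_mult_action actB w (right_mult_action actB v x)"
    by (simp_all add: right_mult_action_opp opp_multiplier_simps opp.A.left_mult_action_simps)
  show "ipB (right_mult_action actB v x) y = ipB x (right_mult_action actB (star v) y)"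
    if v: "v \<in> center"
  proof -
    have "opp_multiplier (star v) \<in> center"
      using v by (simp add: opp_multiplier_center_iff center_closed)
    \<comment> \<open>The opposite inner product swaps its arguments, hence \<open>star v\<close>
      and the exchange of \<open>x\<close> and \<open>y\<close>.\<close>
    from opp.A.ip_left_mult_action_center[OF this, where x = y and y = x] show ?thesis
      unfolding right_mult_action_opp
      by (metis of_opp_to_opp opp_multiplier_simps(5) star_star)
  qed
qed

lemma unitary_center_right_actions:
  "{right_mult_action actB v |v. v \<in> center \<and> unitary v}
    = {T. bij T \<and> bimodule_map actA actB T \<and> preserves_ip ipA T \<and> preserves_ip ipB T}"
proof -
  interpret opp: imprimitivity_bimodule "\<lambda>b x. actB x (of_opp b)" "\<lambda>x y. to_opp (ipB y x)"
    "\<lambda>x a. actA (of_opp a) x" "\<lambda>x y. to_opp (ipA y x)"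
    by (rule imprimitivity_bimodule_opp)
  have "{right_mult_action actB v |v. v \<in> center \<and> unitary v}
      = {left_mult_action (\<lambda>b x. actB x (of_opp b)) u |u. u \<in> center \<and> unitary u}"
  proof (intro subset_antisym subsetI)
    fix T
    assume "T \<in> {left_mult_action (\<lambda>b x. actB x (of_opp b)) u |u. u \<in> center \<and> unitary u}"
    then obtain u where u: "T = left_mult_action (\<lambda>b x. actB x (of_opp b)) u"
        "u \<in> center" "unitary u"
      by blast
    obtain v where "u = opp_multiplier v"
      by (rule opp_multiplier_cases)
    with u show "T \<in> {right_mult_action actB v |v. v \<in> center \<and> unitary v}"
      by (auto simp: opp_multiplier_center_iff unitary_opp_multiplier_iff
          simp flip: right_mult_action_opp)
  next
    fix T
    assume "T \<in> {right_mult_action actB v |v. v \<in> center \<and> unitary v}"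
    then obtain v where "T = right_mult_action actB v" "v \<in> center" "unitary v"
      by blast
    then show "T \<in> {left_mult_action (\<lambda>b x. actB x (of_opp b)) u |u. u \<in> center \<and> unitary u}"
      unfolding right_mult_action_opp
      using opp_multiplier_center_iff unitary_opp_multiplier_iff by blast
  qed
  also have "\<dots> = {T. bij T \<and> bimodule_map actA actB T \<and> preserves_ip ipA T \<and> preserves_ip ipB T}"
    unfolding opp.unitary_center_actions bimodule_map_opp preserves_ip_opp by blast
  finally show ?thesis .
qed

text \<open>Both centers are in bijection with the same set of bimodule maps; \<open>\<Phi>\<close>
  is one bijection followed by the inverse of the other.\<close>

lemma center_isomorphism:
  obtains \<Phi> :: "'a multiplier \<Rightarrow> 'b multiplier"
  where "star_isomorphism_on center center \<Phi>"
    and "\<And>u. u \<in> center \<Longrightarrow> left_mult_action actA u = right_mult_action actB (\<Phi> u)"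
proof -
  let ?F = "left_mult_action actA" and ?G = "right_mult_action actB"
  define \<Phi> where "\<Phi> u = inv_into center ?G (?F u)" for u
  have "bij_betw (inv_into center ?G \<circ> ?F) center center"
    using bij_betw_left_mult_action bij_betw_inv_into[OF bij_betw_right_mult_action]
    by (rule bij_betw_trans)
  then have bij: "bij_betw \<Phi> center center"
    by (simp add: \<Phi>_def comp_def cong: bij_betw_cong)
  then have \<Phi>_center: "\<Phi> u \<in> center" if "u \<in> center" for u
    using that bij_betwE by blast
  have G\<Phi>: "?G (\<Phi> u) = ?F u" if "u \<in> center" for u
    unfolding \<Phi>_def
    using that bij_betw_right_mult_action bij_betwE[OF bij_betw_left_mult_action]
    by (simp add: bij_betw_inv_into_right)
  have \<Phi>_eqI: "\<Phi> u = v" if "u \<in> center" "v \<in> center" "\<And>x. ?F u x = ?G v x" for u v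
    using that G\<Phi>[of u] \<Phi>_center[of u] bij_betw_right_mult_action
    by (metis (no_types, lifting) bij_betw_imp_inj_on ext inj_onD)
  have "star_isomorphism_on center center \<Phi>"
    unfolding star_isomorphism_on_def
  proof (intro conjI ballI allI)
    fix u v :: "'a multiplier"
    assume u: "u \<in> center" and v: "v \<in> center"
    show "\<Phi> (u + v) = \<Phi> u + \<Phi> v"
      by (rule \<Phi>_eqI) (use u v \<Phi>_center in
        \<open>simp_all add: center_closed G\<Phi> right_mult_action_simps A.left_mult_action_simps\<close>)
    \<comment> \<open>Right actions compose in reverse order; commutativity of the center
      compensates.\<close>
    have "u * v = v * u"
      using u by (simp add: center_def)
    then show "\<Phi> (u * v) = \<Phi> u * \<Phi> v"
      by (intro \<Phi>_eqI) (use u v \<Phi>_center in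
        \<open>simp_all add: center_closed G\<Phi> right_mult_action_simps A.left_mult_action_simps\<close>)
  next
    fix c and u :: "'a multiplier"
    assume u: "u \<in> center"
    show "\<Phi> (c *\<^sub>C u) = c *\<^sub>C \<Phi> u"
      by (rule \<Phi>_eqI) (use u \<Phi>_center in
        \<open>simp_all add: center_closed G\<Phi> right_mult_action_simps A.left_mult_action_simps\<close>)
  next
    fix u :: "'a multiplier"
    assume u: "u \<in> center"
    \<comment> \<open>Both are adjoints of the same operator for \<open>ipB\<close>, and adjoints
      are unique.\<close>
    have "?F (star u) x = ?G (star (\<Phi> u)) x" for x
    proof (rule B.eq_if_ip_eq)
      fix y
      have "ipB y (?F (star u) x) = ipB y (?G (star (\<Phi> u)) x)"
        using ipB_left_mult_action_center[OF u, of y x]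
          ipB_right_mult_action_center[OF \<Phi>_center[OF u], of y x]
        by (simp add: G\<Phi>[OF u])
      then show "ipB (?F (star u) x) y = ipB (?G (star (\<Phi> u)) x) y"
        by (metis B.ip_star)
    qed
    then show "\<Phi> (star u) = star (\<Phi> u)"
      by (intro \<Phi>_eqI) (use u \<Phi>_center in \<open>simp_all add: center_closed\<close>)
  qed (rule bij)
  with that show thesis
    using G\<Phi> by metis
qed

end

theorem theorem2p2:
  fixes actA :: "'a::cstar_algebra \<Rightarrow> 'x::{complex_normed_vector, banach} \<Rightarrow> 'x"
    and ipA :: "'x \<Rightarrow> 'x \<Rightarrow> 'a"
    and actB :: "'x \<Rightarrow> 'b::cstar_algebra \<Rightarrow> 'x"
    and ipB :: "'x \<Rightarrow> 'x \<Rightarrow> 'b"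
  assumes "imprimitivity_bimodule actA ipA actB ipB"
  shows "(\<exists>\<Phi> :: 'a multiplier \<Rightarrow> 'b multiplier. star_isomorphism_on center center \<Phi> \<and>
            (\<forall>u\<in>center. left_mult_action actA u = right_mult_action actB (\<Phi> u))) \<and>
    {T. bij T \<and> bounded_clinear T \<and> (\<forall>a x. T (actA a x) = actA a (T x)) \<and>
        preserves_ip ipA T \<and> preserves_ip ipB T}
      = {left_mult_action actA u |u. u \<in> center \<and> unitary u} \<and>
    {T. bij T \<and> bounded_clinear T \<and> (\<forall>x b. T (actB x b) = actB (T x) b) \<and>
        preserves_ip ipA T \<and> preserves_ip ipB T}
      = {left_mult_action actA u |u. u \<in> center \<and> unitary u} \<and>
    {left_mult_action actA u |u. u \<in> center \<and> unitary u}
      = {right_mult_action actB v |v. v \<in> center \<and> unitary v}"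
proof -
  interpret imprimitivity_bimodule actA ipA actB ipB
    by (rule assms)
  show ?thesis
    \<comment> \<open>All sets of actions become the set of bijective bimodule maps preserving both
      inner products; linearity over either algebra implies the other.\<close>
    unfolding unitary_center_actions unitary_center_right_actions bimodule_map_def
    using center_isomorphism actB_linear_if_actA_linear actA_linear_if_actB_linear
    by (intro conjI Collect_cong) metis+
qed

end
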